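(* Assume that, for some constant $\varepsilon>0$, there is an algorithm that in $O(n^{2-\varepsilon})$ time solves the following problem: given an undirected graph $G$ with $n$ vertices and $O(n)$ edges, all of unit length, and given a subgraph $H$ of $G$, decide whether $H$ is an isometric subgraph of $G$. Then the Orthogonal Vectors Conjecture (OVC) and the Strong Exponential Time Hypothesis (SETH) both fail. The same holds for the problem of deciding whether $H$ is a (geodesically) convex subgraph of $G$.
   Context: $H\subseteq G$ is isometric if $d_G(x,y)=d_H(x,y)$ for all $x,y\in V(H)$, where $d_F$ denotes shortest-path distance in $F$; $H$ is convex if for all $x,y\in V(H)$ every shortest $x$-to-$y$ path of $G$ lies in $H$. OVC: for every $\varepsilon>0$ there is $c\ge1$ such that, given $n$ vectors $v_1,\dots,v_n\in\{0,1\}^d$ with $d=\lceil c\log n\rceil$, deciding whether there exist $i,j$ with $\langle v_i,v_j\rangle=0$ cannot be done in $O(n^{2-\varepsilon})$ time. SETH: for every $\varepsilon>0$ there is an integer $k\ge3$ such that $k$-SAT on $n$ variables cannot be solved in $O(2^{(1-\varepsilon)n})$ time. *)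

theory Defs
  imports Complex_Main "HOL-Library.Extended_Nat" "HOL-Library.Landau_Symbols"
begin

section \<open>Undirected graphs, isometric and convex subgraphs\<close>

type_synonym 'a ugraph = "'a set \<times> 'a set set"

abbreviation verts :: "'a ugraph \<Rightarrow> 'a set" where "verts \<equiv> fst"
abbreviation edges :: "'a ugraph \<Rightarrow> 'a set set" where "edges \<equiv> snd"

definition simple_graph :: "'a ugraph \<Rightarrow> bool" where
  "simple_graph G \<longleftrightarrow> finite (verts G) \<and>
     (\<forall>e \<in> edges G. \<exists>u v. u \<in> verts G \<and> v \<in> verts G \<and> u \<noteq> v \<and> e = {u, v})"

definition subgraph :: "'a ugraph \<Rightarrow> 'a ugraph \<Rightarrow> bool" where
  "subgraph H G \<longleftrightarrow> simple_graph H \<and> simple_graph G \<and>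
     verts H \<subseteq> verts G \<and> edges H \<subseteq> edges G"

definition lies_in :: "'a list \<Rightarrow> 'a ugraph \<Rightarrow> bool" where
  "lies_in p G \<longleftrightarrow> set p \<subseteq> verts G \<and>
     (\<forall>i. Suc i < length p \<longrightarrow> {p ! i, p ! Suc i} \<in> edges G)"

definition is_path :: "'a ugraph \<Rightarrow> 'a \<Rightarrow> 'a \<Rightarrow> 'a list \<Rightarrow> bool" where
  "is_path G x y p \<longleftrightarrow>
     p \<noteq> [] \<and> hd p = x \<and> last p = y \<and> distinct p \<and> lies_in p G"

text \<open>The infimum over the empty set is \<open>\<infinity>\<close>: vertices in different components
  are at infinite distance.\<close>

definition gdist :: "'a ugraph \<Rightarrow> 'a \<Rightarrow> 'a \<Rightarrow> enat" where
  "gdist G x y = (INF p \<in> {p. is_path G x y p}. enat (length p - 1))"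

definition is_shortest_path :: "'a ugraph \<Rightarrow> 'a \<Rightarrow> 'a \<Rightarrow> 'a list \<Rightarrow> bool" where
  "is_shortest_path G x y p \<longleftrightarrow> is_path G x y p \<and> enat (length p - 1) = gdist G x y"

definition isometric_subgraph :: "'a ugraph \<Rightarrow> 'a ugraph \<Rightarrow> bool" where
  "isometric_subgraph H G \<longleftrightarrow> subgraph H G \<and>
     (\<forall>x \<in> verts H. \<forall>y \<in> verts H. gdist G x y = gdist H x y)"

definition convex_subgraph :: "'a ugraph \<Rightarrow> 'a ugraph \<Rightarrow> bool" where
  "convex_subgraph H G \<longleftrightarrow> subgraph H G \<and>
     (\<forall>x \<in> verts H. \<forall>y \<in> verts H. \<forall>p. is_shortest_path G x y p \<longrightarrow> lies_in p H)"


section \<open>Word RAM\<close>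

text \<open>
  Unit-cost word RAM, presented as a structured language. A program mentions finitely many
  registers and finitely many arrays; cells hold natural numbers. (Jumps and a single
  memory instead of while loops and several arrays change running times by constant
  factors only.)
\<close>

datatype binop =
    OpAdd | OpSub | OpMul | OpDiv | OpMod
  | OpAnd | OpOr | OpXor | OpShl | OpShr
  | OpLess | OpEq

context
  includes bit_operations_syntax
begin

fun eval_op :: "binop \<Rightarrow> nat \<Rightarrow> nat \<Rightarrow> nat" where
  "eval_op OpAdd a b = a + b"
| "eval_op OpSub a b = a - b"
| "eval_op OpMul a b = a * b"
| "eval_op OpDiv a b = a div b"
| "eval_op OpMod a b = a mod b"
| "eval_op OpAnd a b = a AND b"
| "eval_op OpOr a b = a OR b"
| "eval_op OpXor a b = a XOR b"
| "eval_op OpShl a b = push_bit b a"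
| "eval_op OpShr a b = drop_bit b a"
| "eval_op OpLess a b = of_bool (a < b)"
| "eval_op OpEq a b = of_bool (a = b)"

end

datatype com =
    Skip
  | Const nat nat            \<comment> \<open>\<open>Const r k\<close>: \<open>r := k\<close>\<close>
  | Op binop nat nat nat     \<comment> \<open>\<open>Op f r s t\<close>: \<open>r := f s t\<close>\<close>
  | Load nat nat nat         \<comment> \<open>\<open>Load r a s\<close>: \<open>r := a[s]\<close>\<close>
  | Store nat nat nat        \<comment> \<open>\<open>Store a s r\<close>: \<open>a[s] := r\<close>\<close>
  | Seq com com
  | IfNZ nat com com
  | WhileNZ nat com

text \<open>A state gives the register contents and, for each array name, the array contents.\<close>

type_synonym state = "(nat \<Rightarrow> nat) \<times> (nat \<Rightarrow> nat \<Rightarrow> nat)"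

text \<open>
  \<open>exec B c s t s'\<close>: started in \<open>s\<close>, program \<open>c\<close> halts in \<open>s'\<close> after \<open>t\<close> steps, and every
  value placed in a register is less than \<open>B\<close>, i.e. fits into a word of \<open>log 2 B\<close> bits.
  Overflow is not wrapped around: a computation that would overflow has no derivation.
\<close>

inductive exec :: "nat \<Rightarrow> com \<Rightarrow> state \<Rightarrow> nat \<Rightarrow> state \<Rightarrow> bool" for B :: nat where
  Skip: "exec B Skip s 1 s"
| Const: "k < B \<Longrightarrow> exec B (Const r k) (R, M) 1 (R(r := k), M)"
| Op: "eval_op f (R x) (R y) < B \<Longrightarrow>
    exec B (Op f r x y) (R, M) 1 (R(r := eval_op f (R x) (R y)), M)"
| Load: "M a (R x) < B \<Longrightarrow> exec B (Load r a x) (R, M) 1 (R(r := M a (R x)), M)"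
| Store: "exec B (Store a x r) (R, M) 1 (R, M(a := (M a)(R x := R r)))"
| Seq: "exec B c1 s t1 s' \<Longrightarrow> exec B c2 s' t2 s'' \<Longrightarrow> exec B (Seq c1 c2) s (t1 + t2) s''"
| IfTrue: "fst s r \<noteq> 0 \<Longrightarrow> exec B c1 s t s' \<Longrightarrow> exec B (IfNZ r c1 c2) s (Suc t) s'"
| IfFalse: "fst s r = 0 \<Longrightarrow> exec B c2 s t s' \<Longrightarrow> exec B (IfNZ r c1 c2) s (Suc t) s'"
| WhileFalse: "fst s r = 0 \<Longrightarrow> exec B (WhileNZ r c) s 1 s"
| WhileTrue: "fst s r \<noteq> 0 \<Longrightarrow> exec B c s t1 s' \<Longrightarrow> exec B (WhileNZ r c) s' t2 s'' \<Longrightarrow>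
    exec B (WhileNZ r c) s (Suc (t1 + t2)) s''"

text \<open>The input is in array 0; everything else is initially 0. The answer is in register 0.\<close>

definition init_state :: "nat list \<Rightarrow> state" where
  "init_state xs =
     ((\<lambda>_. 0), (\<lambda>a i. if a = 0 \<and> i < length xs then xs ! i else 0))"

definition answers_within :: "com \<Rightarrow> nat \<Rightarrow> nat list \<Rightarrow> nat \<Rightarrow> bool \<Rightarrow> bool" where
  "answers_within P B xs t b \<longleftrightarrow>
     (\<exists>t' R M. exec B P (init_state xs) t' (R, M) \<and> t' \<le> t \<and> R 0 = of_bool b)"

text \<open>
  Decidability of a problem in time \<open>O(g)\<close>, where \<open>sz\<close> is the parameter in which time is
  measured, and only inputs in \<open>Inst\<close> matter. The word length is
  \<open>\<kappa> * log 2 (n + T n + 2)\<close> bits for a constant \<open>\<kappa>\<close>: this is \<open>O(log n)\<close> for polynomial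
  time bounds, and \<open>O(n)\<close> for time bounds \<open>2 ^ O(n)\<close>.
\<close>

definition decidable_in_time ::
  "'a set \<Rightarrow> ('a \<Rightarrow> nat) \<Rightarrow> ('a \<Rightarrow> nat list) \<Rightarrow> ('a \<Rightarrow> bool) \<Rightarrow> (nat \<Rightarrow> real) \<Rightarrow> bool" where
  "decidable_in_time Inst sz enc yes g \<longleftrightarrow>
     (\<exists>(P :: com) (\<kappa> :: nat) (T :: nat \<Rightarrow> nat). (\<lambda>n. real (T n)) \<in> O(g) \<and>
        (\<forall>x \<in> Inst. answers_within P ((sz x + T (sz x) + 2) ^ \<kappa>) (enc x) (T (sz x)) (yes x)))"


section \<open>Orthogonal Vectors Conjecture\<close>

definition ov_instances :: "real \<Rightarrow> nat list list set" where
  "ov_instances c = {vs. vs \<noteq> [] \<and>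
     (\<forall>v \<in> set vs. length v = nat \<lceil>c * log 2 (real (length vs))\<rceil> \<and> set v \<subseteq> {0, 1})}"

definition inner_prod :: "nat list \<Rightarrow> nat list \<Rightarrow> nat" where
  "inner_prod u v = (\<Sum>k < length u. u ! k * v ! k)"

definition has_orthogonal_pair :: "nat list list \<Rightarrow> bool" where
  "has_orthogonal_pair vs \<longleftrightarrow>
     (\<exists>i < length vs. \<exists>j < length vs. inner_prod (vs ! i) (vs ! j) = 0)"

definition enc_ov :: "nat list list \<Rightarrow> nat list" where
  "enc_ov vs = [length vs, length (hd vs)] @ concat vs"

definition OVC :: bool where
  "OVC \<longleftrightarrow> (\<forall>\<epsilon>::real. \<epsilon> > 0 \<longrightarrow> (\<exists>c::real. c \<ge> 1 \<and>
     \<not> decidable_in_time (ov_instances c) length enc_ov has_orthogonal_pair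
         (\<lambda>n. real n powr (2 - \<epsilon>))))"


section \<open>Strong Exponential Time Hypothesis\<close>

text \<open>\<open>(x, True)\<close> is the literal \<open>x\<close>, and \<open>(x, False)\<close> its negation. In an instance
  \<open>(n, \<phi>)\<close> the variables are \<open>0, \<dots>, n - 1\<close>.\<close>

type_synonym literal = "nat \<times> bool"

definition satisfiable :: "nat \<times> literal list list \<Rightarrow> bool" where
  "satisfiable = (\<lambda>(n, \<phi>).
     \<exists>\<alpha> :: nat \<Rightarrow> bool. \<forall>cl \<in> set \<phi>. \<exists>(x, b) \<in> set cl. \<alpha> x = b)"

text \<open>A formula is a set of clauses, and a clause is a set of literals. Without the
  distinctness of the clauses the input length would not be bounded in terms of \<open>n\<close>.\<close>

definition ksat_instances :: "nat \<Rightarrow> (nat \<times> literal list list) set" where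
  "ksat_instances k = {(n, \<phi>). distinct (map set \<phi>) \<and>
     (\<forall>cl \<in> set \<phi>. distinct cl \<and> length cl \<le> k \<and> (\<forall>(x, b) \<in> set cl. x < n))}"

definition enc_cnf :: "nat \<times> literal list list \<Rightarrow> nat list" where
  "enc_cnf = (\<lambda>(n, \<phi>). [n, length \<phi>] @
     concat (map (\<lambda>cl. length cl # map (\<lambda>(x, b). 2 * x + of_bool b) cl) \<phi>))"

definition SETH :: bool where
  "SETH \<longleftrightarrow> (\<forall>\<epsilon>::real. \<epsilon> > 0 \<longrightarrow> (\<exists>k::nat. k \<ge> 3 \<and>
     \<not> decidable_in_time (ksat_instances k) fst enc_cnf satisfiable
         (\<lambda>n. 2 powr ((1 - \<epsilon>) * real n))))"


section \<open>Recognizing isometric and convex subgraphs of sparse graphs\<close>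

text \<open>An instance \<open>(n, es, vs, fs)\<close> consists of the number of vertices and the list of edges
  of \<open>G\<close>, and the lists of vertices and edges of \<open>H\<close>.\<close>

type_synonym graph_instance = "nat \<times> (nat \<times> nat) list \<times> nat list \<times> (nat \<times> nat) list"

definition edge :: "nat \<times> nat \<Rightarrow> nat set" where
  "edge = (\<lambda>(u, v). {u, v})"

definition host_graph :: "graph_instance \<Rightarrow> nat ugraph" where
  "host_graph = (\<lambda>(n, es, vs, fs). ({..<n}, edge ` set es))"

definition sub_graph :: "graph_instance \<Rightarrow> nat ugraph" where
  "sub_graph = (\<lambda>(n, es, vs, fs). (set vs, edge ` set fs))"

definition sparse_instances :: "real \<Rightarrow> graph_instance set" where
  "sparse_instances C = {(n, es, vs, fs).
     distinct (map edge es) \<and> distinct vs \<and> distinct (map edge fs) \<and>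
     subgraph (sub_graph (n, es, vs, fs)) (host_graph (n, es, vs, fs)) \<and>
     real (length es) \<le> C * real n}"

definition enc_graph :: "graph_instance \<Rightarrow> nat list" where
  "enc_graph = (\<lambda>(n, es, vs, fs). [n, length es, length vs, length fs] @
     concat (map (\<lambda>(u, v). [u, v]) es) @ vs @ concat (map (\<lambda>(u, v). [u, v]) fs))"

definition isometric_decidable :: "real \<Rightarrow> (nat \<Rightarrow> real) \<Rightarrow> bool" where
  "isometric_decidable C g \<longleftrightarrow> decidable_in_time (sparse_instances C) fst enc_graph
     (\<lambda>I. isometric_subgraph (sub_graph I) (host_graph I)) g"

definition convex_decidable :: "real \<Rightarrow> (nat \<Rightarrow> real) \<Rightarrow> bool" where
  "convex_decidable C g \<longleftrightarrow> decidable_in_time (sparse_instances C) fst enc_graph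
     (\<lambda>I. convex_subgraph (sub_graph I) (host_graph I)) g"

end

theory Submission
  imports Defs "HOL-Real_Asymp.Real_Asymp"
begin

text \<open>
  Two families of 0/1 vectors become the two halves of \<open>2 * p\<close> \<^emph>\<open>ports\<close>. Coordinate \<open>k\<close> gives an
  edge between two \<^emph>\<open>colour\<close> vertices, one for each half, and a port is joined to the colour vertex
  of its half exactly if its vector has a one there. Two hubs bring ports of the same half to
  distance 2. Hence two ports of different halves are at distance 3 if they have a common one, and
  at distance at least 5 otherwise, by a parity argument. This graph is \<open>H\<close>; in \<open>G\<close> every two ports
  are in addition joined by a bypass of length 4 through a common centre. So if no pair is orthogonal,
  no shortest path between vertices of \<open>H\<close> takes a bypass and \<open>H\<close> is convex, and otherwise
  \<open>H\<close> is not even isometric. Isolated vertices make \<open>G\<close> as sparse as desired.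

  Satisfiability is reduced directly: the ports are the assignments of either half of the variables,
  the coordinates are the clauses, with a one where the assignment does not satisfy the clause.
  Since the dimension need not be logarithmic, no sparsification lemma is needed.
\<close>

section \<open>Walks and distances\<close>

text \<open>A separate bypass for each of the \<open>p * p\<close> pairs would make the graph
  quadratic; the common centre provides all of them with \<open>4 * p\<close> edges. The price is
  that it also links ports of the same half, which is why the hubs must already bring these to
  distance 2. The length 4 has to lose against a common one and to win otherwise: it lies strictly
  between 3 and 5, and the bipartiteness of \<open>H\<close> rules out that the distance in
  \<open>H\<close> is 4 as well. For fixed \<open>K\<close> the graph has
  O(\<open>p * (D + 1)\<close>) vertices. For vectors \<open>p = n\<close> and \<open>D\<close> is
  logarithmic; for formulas \<open>p\<close> is about 2 to the \<open>n / 2\<close> and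
  \<open>D\<close> is polynomial in \<open>n\<close>, so an exponent below 2 brings the time below 2
  to the \<open>n\<close>. The reduction has to run within the word RAM, where overflow means
  failure. One quantity, \<open>p * (D + 1) * (\<tau> + 1)\<close> with \<open>\<tau>\<close> the
  cost of one query to \<open>Q\<close>, therefore bounds running time, graph size and register
  contents up to constants.\<close>

lemma lies_in_iff:
  "lies_in w G \<longleftrightarrow> set w \<subseteq> verts G \<and> successively (\<lambda>u v. {u, v} \<in> edges G) w"
  unfolding lies_in_def successively_conv_nth by auto

text \<open>Distances are defined by paths without repeated vertices, but the detours built later
  may revisit vertices. Cutting out a closed section shortens a walk and keeps its ends.\<close>

lemma gdist_le_walk:
  assumes "w \<noteq> []" "lies_in w G"
  shows "gdist G (hd w) (last w) \<le> enat (length w - 1)"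
  using assms
proof (induction "length w" arbitrary: w rule: less_induct)
  case less
  show ?case
  proof (cases "distinct w")
    case True
    then have "is_path G (hd w) (last w) w"
      using less.prems by (simp add: is_path_def)
    then show ?thesis unfolding gdist_def by (intro INF_lower) simp
  next
    case False
    then obtain xs ys zs v where w: "w = xs @ [v] @ ys @ [v] @ zs"
      using not_distinct_decomp by blast
    define w' where "w' = xs @ [v] @ zs"
    have "lies_in w' G"
      using less.prems(2) unfolding w w'_def lies_in_iff
      by (auto simp: successively_append_iff successively_Cons)
    then have "gdist G (hd w') (last w') \<le> enat (length w' - 1)"
      by (intro less.hyps) (auto simp: w w'_def)
    moreover have "hd w' = hd w" "last w' = last w"
      by (auto simp: w w'_def hd_append)
    moreover have "length w' - 1 \<le> length w - 1" by (simp add: w w'_def)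
    ultimately show ?thesis by (metis enat_ord_simps(1) order_trans)
  qed
qed

lemma exists_shortest_path:
  assumes "is_path G x y w"
  obtains q where "is_shortest_path G x y q"
proof -
  have "(INF q \<in> {q. is_path G x y q}. enat (length q - 1))
      \<in> (\<lambda>q. enat (length q - 1)) ` {q. is_path G x y q}"
    using assms wellorder_InfI[of "enat (length w - 1)"] by (intro wellorder_InfI) auto
  then show ?thesis using that unfolding is_shortest_path_def gdist_def by auto
qed

text \<open>A shortest path of \<open>G\<close> stays in \<open>H\<close> and so bounds the distance
  in \<open>H\<close>; it exists because a nonempty infimum in \<open>enat\<close> is attained. This
  implication lets one gadget serve both decision problems.\<close>

lemma convex_imp_isometric:
  assumes "convex_subgraph H G"
  shows "isometric_subgraph H G"
  unfolding isometric_subgraph_def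
proof (intro conjI ballI)
  show sub: "subgraph H G" using assms by (simp add: convex_subgraph_def)
  fix x y assume xy: "x \<in> verts H" "y \<in> verts H"
  have "{w. is_path H x y w} \<subseteq> {w. is_path G x y w}"
    using sub unfolding is_path_def lies_in_def subgraph_def by blast
  then have "gdist G x y \<le> gdist H x y"
    unfolding gdist_def by (rule INF_superset_mono) (rule order_refl)
  moreover have "gdist H x y \<le> gdist G x y"
  proof (cases "\<exists>w. is_path G x y w")
    case True
    then obtain w where "is_path G x y w" ..
    then obtain q where q: "is_shortest_path G x y q" by (rule exists_shortest_path)
    then have "lies_in q H" using assms xy by (auto simp: convex_subgraph_def)
    then have "is_path H x y q" using q by (simp add: is_shortest_path_def is_path_def)
    then have "gdist H x y \<le> enat (length q - 1)" unfolding gdist_def by (intro INF_lower) simp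
    then show ?thesis using q by (simp add: is_shortest_path_def)
  next
    case False
    then have "gdist G x y = \<infinity>" by (simp add: gdist_def top_enat_def)
    then show ?thesis by simp
  qed
  ultimately show "gdist G x y = gdist H x y" by (rule antisym)
qed

text \<open>A certificate for lower bounds on distances: exhibiting one such \<open>f\<close>
  replaces a case analysis over all short walks.\<close>

lemma potential_le_length:
  fixes f :: "'a \<Rightarrow> nat"
  assumes "w \<noteq> []" "lies_in w G"
    and "\<And>u v. {u, v} \<in> edges G \<Longrightarrow> f v \<le> Suc (f u)"
  shows "f (last w) \<le> f (hd w) + (length w - 1)"
  using assms(1,2)
proof (induction w rule: induct_list012)
  case (3 u v w)
  then have "f (last (v # w)) \<le> f v + length w" "{u, v} \<in> edges G"
    by (auto simp: lies_in_iff)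
  then show ?case using assms(3)[of u v] by auto
qed auto

section \<open>The reduction graph\<close>

text \<open>
  Numbering: the ports are \<open>0, \<dots>, 2 * p - 1\<close>, and \<open>t div p\<close> is the half of port \<open>t\<close>; the hubs are \<open>2 * p\<close> and
  \<open>2 * p + 1\<close>; the colour vertices of \<open>k\<close> are \<open>2 * p + 2 + 2 * k\<close> and its successor. From \<open>core_size\<close>
  on there follow the centre of the bypasses, their other inner vertices, and the isolated vertices.
\<close>

definition core_size :: "nat \<Rightarrow> nat \<Rightarrow> nat" where
  "core_size p D = 2 * p + 2 + 2 * D"

text \<open>Even single edges are written as lists under \<open>concat\<close> and
  \<open>map\<close>, because this is the shape in which nested counting loops produce their output
  (see \<open>emits_For\<close>).\<close>

definition core_edges :: "nat \<Rightarrow> nat \<Rightarrow> (nat \<Rightarrow> nat \<Rightarrow> bool) \<Rightarrow> (nat \<times> nat) list" where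
  "core_edges p D Q =
     concat (map (\<lambda>k. [(2 * p + 2 + 2 * k, 2 * p + 3 + 2 * k)]) [0..<D]) @
     concat (map (\<lambda>t. (t, 2 * p + t div p) #
       concat (map (\<lambda>k. if Q t k then [(t, 2 * p + 2 + 2 * k + t div p)] else []) [0..<D]))
     [0..<2 * p])"

definition bypass_edges :: "nat \<Rightarrow> nat \<Rightarrow> (nat \<times> nat) list" where
  "bypass_edges p D = concat (map (\<lambda>t.
     [(t, core_size p D + 1 + t), (core_size p D, core_size p D + 1 + t)]) [0..<2 * p])"

definition gadget :: "nat \<Rightarrow> nat \<Rightarrow> nat \<Rightarrow> (nat \<Rightarrow> nat \<Rightarrow> bool) \<Rightarrow> graph_instance" where
  "gadget K p D Q =
     (let es = core_edges p D Q @ bypass_edges p D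
      in (core_size p D + 1 + 2 * p + K * length es, es, [0..<core_size p D], core_edges p D Q))"

definition avoiding_pair :: "nat \<Rightarrow> nat \<Rightarrow> (nat \<Rightarrow> nat \<Rightarrow> bool) \<Rightarrow> bool" where
  "avoiding_pair p D Q \<longleftrightarrow> (\<exists>i < p. \<exists>j < p. \<forall>k < D. \<not> (Q i k \<and> Q (p + j) k))"

section \<open>Incidence, subgraph relation and sparsity of the gadget\<close>

lemma edge_in_image_iff: "{u, v} \<in> edge ` S \<longleftrightarrow> (u, v) \<in> S \<or> (v, u) \<in> S"
  by (force simp: edge_def doubleton_eq_iff)

lemma mem_core_edges:
  "(u, v) \<in> set (core_edges p D Q) \<longleftrightarrow>
     (\<exists>k < D. u = 2 * p + 2 + 2 * k \<and> v = 2 * p + 3 + 2 * k) \<or>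
     (u < 2 * p \<and> v = 2 * p + u div p) \<or>
     (u < 2 * p \<and> (\<exists>k < D. Q u k \<and> v = 2 * p + 2 + 2 * k + u div p))"
  unfolding core_edges_def by (auto simp: image_iff split: if_splits)

lemma mem_bypass_edges:
  "(u, v) \<in> set (bypass_edges p D) \<longleftrightarrow>
     (\<exists>t < 2 * p. (u = t \<or> u = core_size p D) \<and> v = core_size p D + 1 + t)"
  unfolding bypass_edges_def by (auto simp: image_iff)

lemma port_side: "(t::nat) < 2 * p \<Longrightarrow> t div p = (if t < p then 0 else 1)"
  by (auto intro: div_nat_eqI)

lemma port_side_less: "(t::nat) < 2 * p \<Longrightarrow> t div p < 2"
  by (simp add: port_side)

lemma core_edges_bound:
  assumes "(u, v) \<in> set (core_edges p D Q)"
  shows "u < v" "v < core_size p D"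
  using assms port_side_less[of u p] by (auto simp: mem_core_edges core_size_def)

lemma bypass_edges_bound:
  assumes "(u, v) \<in> set (bypass_edges p D)"
  shows "u < v" "core_size p D < v" "v < core_size p D + 1 + 2 * p"
  using assms by (auto simp: mem_bypass_edges core_size_def)

lemma distinct_concat_map_upt:
  assumes "\<And>t. t < n \<Longrightarrow> distinct (f t)"
    and "\<And>s t x. s < n \<Longrightarrow> t < n \<Longrightarrow> x \<in> set (f s) \<Longrightarrow> x \<in> set (f t) \<Longrightarrow> s = t"
  shows "distinct (concat (map f [0..<n]))"
  using assms
proof (induction n)
  case (Suc n)
  have "distinct (concat (map f [0..<n]))" using Suc.prems by (intro Suc.IH) auto
  moreover have "x \<notin> set (f n)" if "s < n" "x \<in> set (f s)" for s x
    using Suc.prems(2)[of s n x] that by auto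
  ultimately show ?case using Suc.prems(1)[of n] by auto
qed simp

lemma distinct_core_edges: "distinct (core_edges p D Q)"
  unfolding core_edges_def distinct_append
  by (intro conjI distinct_concat_map_upt)
    (auto intro!: distinct_concat_map_upt split: if_splits)

lemma distinct_bypass_edges: "distinct (bypass_edges p D)"
  unfolding bypass_edges_def
  by (rule distinct_concat_map_upt) (auto simp: core_size_def)

lemma distinct_map_edge:
  assumes "distinct es" "\<And>u v. (u, v) \<in> set es \<Longrightarrow> u < v"
  shows "distinct (map edge es)"
proof -
  have "inj_on edge (set es)"
    by (rule inj_onI) (auto simp: edge_def doubleton_eq_iff dest!: assms(2))
  then show ?thesis using assms(1) by (simp add: distinct_map)
qed

lemma gadget_edges_ord:
  assumes "(u, v) \<in> set (core_edges p D Q @ bypass_edges p D)"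
  shows "u < v" "v < core_size p D + 1 + 2 * p"
  using assms core_edges_bound[of u v p D Q] bypass_edges_bound[of u v p D] by auto

lemma simple_graph_ord:
  assumes "\<And>u v. (u, v) \<in> set es \<Longrightarrow> u < v \<and> v < (N :: nat)"
  shows "simple_graph ({..<N}, edge ` set es)"
  unfolding simple_graph_def
proof (intro conjI ballI)
  fix e assume "e \<in> edges ({..<N}, edge ` set es)"
  then obtain u v where "(u, v) \<in> set es" "e = {u, v}" by (auto simp: edge_def)
  then show "\<exists>u v. u \<in> verts ({..<N}, edge ` set es) \<and> v \<in> verts ({..<N}, edge ` set es) \<and>
      u \<noteq> v \<and> e = {u, v}"
    using assms[of u v] by (intro exI[of _ u] exI[of _ v]) auto
qed simp

lemma gadget_subgraph: "subgraph (sub_graph (gadget K p D Q)) (host_graph (gadget K p D Q))"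
proof -
  define es where "es = core_edges p D Q @ bypass_edges p D"
  define N where "N = core_size p D + 1 + 2 * p + K * length es"
  have ord: "u < v \<and> v < N" if "(u, v) \<in> set es" for u v
    using gadget_edges_ord[of u v p D Q] that by (simp add: es_def N_def)
  have "simple_graph ({..<N}, edge ` set es)"
    by (rule simple_graph_ord) (use ord in blast)
  moreover have "simple_graph ({..<core_size p D}, edge ` set (core_edges p D Q))"
    by (rule simple_graph_ord) (use core_edges_bound in blast)
  moreover have "core_size p D \<le> N" by (simp add: N_def)
  ultimately show ?thesis
    unfolding gadget_def Let_def es_def[symmetric] N_def[symmetric]
    by (auto simp: sub_graph_def host_graph_def subgraph_def es_def lessThan_atLeast0)
qed

text \<open>Every edge comes with \<open>K\<close> isolated vertices, and \<open>C * K\<close> is at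
  least 1, so these vertices alone pay for all edges.\<close>

lemma gadget_sparse:
  assumes "C > 0" "1 / C \<le> real K"
  shows "gadget K p D Q \<in> sparse_instances C"
proof -
  define es where "es = core_edges p D Q @ bypass_edges p D"
  define N where "N = core_size p D + 1 + 2 * p + K * length es"
  have "distinct es"
    using core_edges_bound(2) bypass_edges_bound(2)
    by (fastforce simp: es_def distinct_core_edges distinct_bypass_edges)
  then have "distinct (map edge es)"
    by (rule distinct_map_edge) (simp add: es_def gadget_edges_ord(1))
  moreover have "distinct (map edge (core_edges p D Q))"
    by (rule distinct_map_edge) (auto simp: distinct_core_edges dest: core_edges_bound)
  moreover have "real (length es) \<le> C * real N"
  proof -
    have "1 \<le> C * real K" using assms by (simp add: field_simps)
    then have "real (length es) \<le> (C * real K) * real (length es)"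
      by (metis mult_right_mono mult_1 of_nat_0_le_iff)
    also have "\<dots> = C * real (K * length es)" by simp
    also have "\<dots> \<le> C * real N" using assms(1) by (intro mult_left_mono) (auto simp: N_def)
    finally show ?thesis .
  qed
  ultimately show ?thesis
    using gadget_subgraph[of K p D Q]
    unfolding gadget_def Let_def es_def[symmetric] N_def[symmetric]
    by (auto simp: sparse_instances_def)
qed

section \<open>Shortest paths of the gadget\<close>

lemma gadget_convex:
  assumes none: "\<not> avoiding_pair p D Q"
  shows "convex_subgraph (sub_graph (gadget K p D Q)) (host_graph (gadget K p D Q))"
proof -
  define h where "h = core_size p D"
  let ?G = "host_graph (gadget K p D Q)" and ?H = "sub_graph (gadget K p D Q)"
  have vH: "verts ?H = {..<h}"
    by (auto simp: sub_graph_def gadget_def Let_def h_def)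
  have vG: "{..<h} \<subseteq> verts ?G"
    by (auto simp: host_graph_def gadget_def Let_def h_def)
  have eH: "{u, v} \<in> edges ?H \<longleftrightarrow> (u, v) \<in> set (core_edges p D Q) \<or> (v, u) \<in> set (core_edges p D Q)" for u v
    by (auto simp: sub_graph_def gadget_def Let_def edge_in_image_iff)
  have eG: "{u, v} \<in> edges ?G \<longleftrightarrow> {u, v} \<in> edges ?H \<or>
      (u, v) \<in> set (bypass_edges p D) \<or> (v, u) \<in> set (bypass_edges p D)" for u v
    unfolding eH by (auto simp: host_graph_def gadget_def Let_def edge_in_image_iff)
  have eH_less: "u < h \<and> v < h" if "{u, v} \<in> edges ?H" for u v
    using that core_edges_bound[of u v p D Q] core_edges_bound[of v u p D Q] by (auto simp: eH h_def)
  have centre_nb: "\<exists>t < 2 * p. v = h + 1 + t" if "{h, v} \<in> edges ?G" for v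
    using that eH_less[of h v] by (auto simp: eG mem_bypass_edges h_def core_size_def)
  \<comment> \<open>\<open>t\<close> is arbitrary: beyond the inner vertices of the bypasses it
    names isolated vertices, for which the claim is vacuous.\<close>
  have outer_nb: "v = t \<or> v = h" if "{h + 1 + t, v} \<in> edges ?G" for t v
    using that eH_less[of "h + 1 + t" v] by (auto simp: eG mem_bypass_edges h_def core_size_def)
  have AB: "\<exists>c d. {s, c} \<in> edges ?H \<and> {c, d} \<in> edges ?H \<and> {d, t} \<in> edges ?H"
    if st: "s < p" "p \<le> t" "t < 2 * p" for s t
  proof -
    have "t - p < p" "p + (t - p) = t" using st by auto
    then obtain k where k: "k < D" "Q s k" "Q t k"
      using none st(1) unfolding avoiding_pair_def by metis
    have "{s, 2 * p + 2 + 2 * k} \<in> edges ?H" "{2 * p + 2 + 2 * k, 2 * p + 3 + 2 * k} \<in> edges ?H"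
        "{t, 2 * p + 3 + 2 * k} \<in> edges ?H"
      using k st by (auto simp: eH mem_core_edges port_side)
    then show ?thesis
      by (intro exI[of _ "2 * p + 2 + 2 * k"] exI[of _ "2 * p + 3 + 2 * k"])
        (simp add: insert_commute)
  qed
  \<comment> \<open>Three edges of \<open>H\<close> suffice between any two ports, even equal ones,
    against the four edges of a bypass.\<close>
  have detour: "\<exists>ms. length ms \<le> 2 \<and> set ms \<subseteq> {..<h} \<and> successively (\<lambda>u v. {u, v} \<in> edges ?H) (s # ms @ [t])"
    if st: "s < 2 * p" "t < 2 * p" for s t
  proof -
    consider "s div p = t div p" | "s < p" "p \<le> t" | "t < p" "p \<le> s"
      using st by (cases "s < p"; cases "t < p") (auto simp: port_side)
    then show ?thesis
    proof cases
      case 1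
      have "{s, 2 * p + s div p} \<in> edges ?H" "{2 * p + t div p, t} \<in> edges ?H"
        using st by (auto simp: eH mem_core_edges)
      with 1 show ?thesis using eH_less by (intro exI[of _ "[2 * p + s div p]"]) auto
    next
      case 2
      then obtain c d where "{s, c} \<in> edges ?H" "{c, d} \<in> edges ?H" "{d, t} \<in> edges ?H"
        using AB st by blast
      then show ?thesis using eH_less by (intro exI[of _ "[c, d]"]) auto
    next
      case 3
      then obtain c d where "{t, c} \<in> edges ?H" "{c, d} \<in> edges ?H" "{d, s} \<in> edges ?H"
        using AB st by blast
      then show ?thesis using eH_less by (intro exI[of _ "[d, c]"]) (auto simp: insert_commute)
    qed
  qed
  have "lies_in q ?H" if x: "x < h" and y: "y < h" and sp: "is_shortest_path ?G x y q" for x y q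
  proof -
    have q: "q \<noteq> []" "hd q = x" "last q = y" "distinct q"
      and suc: "successively (\<lambda>u v. {u, v} \<in> edges ?G) q" and qv: "set q \<subseteq> verts ?G"
      and min: "enat (length q - 1) = gdist ?G x y"
      using sp by (auto simp: is_shortest_path_def is_path_def lies_in_iff)
    \<comment> \<open>The path ends below \<open>h\<close>, so it must go on after the centre and
      after the next outer vertex; distinctness forbids a return to \<open>h\<close>, which leaves
      only the port.\<close>
    have right: "\<exists>t ys'. t < 2 * p \<and> ys = (h + 1 + t) # t # ys'" if qs: "q = xs @ h # ys" for xs ys
    proof -
      obtain v ys1 where ys: "ys = v # ys1" using qs q(3) y by (cases ys) auto
      then obtain t where t: "t < 2 * p" "v = h + 1 + t"
        using suc qs centre_nb[of v] by (auto simp: successively_append_iff)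
      obtain w ys2 where ys1: "ys1 = w # ys2" using qs q(3) y ys t by (cases ys1) auto
      have "{v, w} \<in> edges ?G" "w \<noteq> h" using suc qs ys ys1 q(4) by (auto simp: successively_append_iff)
      then show ?thesis using outer_nb t ys ys1 by blast
    qed
    have left: "\<exists>t xs'. t < 2 * p \<and> xs = xs' @ [t, h + 1 + t]" if qs: "q = xs @ h # ys" for xs ys
    proof -
      obtain v xs1 where xs: "xs = xs1 @ [v]" using qs q(2) x by (cases xs rule: rev_cases) auto
      then have "{h, v} \<in> edges ?G"
        using suc qs by (auto simp: successively_append_iff insert_commute)
      then obtain t where t: "t < 2 * p" "v = h + 1 + t" using centre_nb by blast
      obtain w xs2 where xs1: "xs1 = xs2 @ [w]" using qs q(2) x xs t by (cases xs1 rule: rev_cases) auto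
      have "{v, w} \<in> edges ?G" "w \<noteq> h"
        using suc qs xs xs1 q(4) by (auto simp: successively_append_iff insert_commute)
      then show ?thesis using outer_nb t xs xs1 by force
    qed
    have centre_notin: "h \<notin> set q"
    proof
      assume "h \<in> set q"
      then obtain xs ys where split: "q = xs @ h # ys" by (meson split_list)
      obtain s xs' where s: "s < 2 * p" "xs = xs' @ [s, h + 1 + s]" using left[OF split] by blast
      obtain t ys' where t: "t < 2 * p" "ys = (h + 1 + t) # t # ys'" using right[OF split] by blast
      obtain ms where ms: "length ms \<le> 2" "set ms \<subseteq> {..<h}"
          "successively (\<lambda>u v. {u, v} \<in> edges ?H) (s # ms @ [t])"
        using detour[OF s(1) t(1)] by blast
      \<comment> \<open>Four bypass edges give way to at most three edges of \<open>H\<close>. The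
        result may repeat vertices, which \<open>gdist_le_walk\<close> tolerates.\<close>
      define w where "w = xs' @ (s # ms @ [t]) @ ys'"
      have sub: "successively (\<lambda>u v. {u, v} \<in> edges ?G) (s # ms @ [t])"
        using ms(3) by (rule successively_mono) (simp add: eG)
      have q_eq: "q = xs' @ [s, h + 1 + s, h, h + 1 + t, t] @ ys'"
        using split s(2) t(2) by simp
      have "successively (\<lambda>u v. {u, v} \<in> edges ?G) (xs' @ (s # ms @ [t]) @ ys')"
        using suc sub unfolding q_eq successively_append_iff by auto
      moreover have "set w \<subseteq> verts ?G"
        using qv subset_trans[OF ms(2) vG] unfolding q_eq w_def by auto
      ultimately have "lies_in w ?G" unfolding lies_in_iff w_def by blast
      moreover have "w \<noteq> []" "hd w = x" "last w = y"
        using q(2,3) by (auto simp: w_def q_eq hd_append)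
      ultimately have "gdist ?G x y \<le> enat (length w - 1)"
        using gdist_le_walk by metis
      moreover have "length w - 1 < length q - 1"
        using ms(1) by (simp add: w_def q_eq)
      ultimately show False using min by (metis enat_ord_simps(1) not_le)
    qed
    \<comment> \<open>With the centre excluded, both neighbours of such a vertex on the path would
      be the same port.\<close>
    have outer_notin: "h + 1 + t \<notin> set q" for t
    proof
      assume "h + 1 + t \<in> set q"
      then obtain xs ys where split: "q = xs @ (h + 1 + t) # ys" by (meson split_list)
      obtain v ys1 where ys: "ys = v # ys1" using split q(3) y by (cases ys) auto
      obtain w xs1 where xs: "xs = xs1 @ [w]" using split q(2) x by (cases xs rule: rev_cases) auto
      have "{h + 1 + t, v} \<in> edges ?G" "{h + 1 + t, w} \<in> edges ?G"
        using suc unfolding split xs ys by (auto simp: successively_append_iff insert_commute)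
      then have "v = t" "w = t"
        using outer_nb centre_notin unfolding split xs ys by force+
      then show False using q(4) unfolding split xs ys by simp
    qed
    have small: "v < h" if "v \<in> set q" for v
    proof (rule ccontr)
      assume "\<not> v < h"
      then have "v = h \<or> v = h + 1 + (v - (h + 1))" by linarith
      with centre_notin outer_notin that show False by metis
    qed
    have "successively (\<lambda>u v. {u, v} \<in> edges ?H) q"
    proof -
      have "{u, v} \<in> edges ?H" if "{u, v} \<in> edges ?G" "u < h" "v < h" for u v
        using that bypass_edges_bound(2)[of u v p D] bypass_edges_bound(2)[of v u p D]
        by (auto simp: eG h_def)
      then show ?thesis
        using suc small unfolding successively_conv_nth by (metis Suc_lessD nth_mem)
    qed
    then show ?thesis using small vH by (auto simp: lies_in_iff)
  qed
  moreover have "subgraph ?H ?G"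
    using gadget_subgraph .
  ultimately show ?thesis unfolding convex_subgraph_def vH by blast
qed

lemma mod2_shift: "(s::nat) < 2 \<Longrightarrow> (2 * a + s) mod 2 = s"
  by simp

text \<open>\<open>H\<close> is bipartite with ports of different halves in different classes, so
  their distance is odd; without a common one it is neither 1 nor 3, while a bypass has length 4.
  The function in the proof encodes this: along core edges it changes by exactly 1, so its parity is
  the bipartition.\<close>

lemma gadget_not_isometric:
  assumes ex: "avoiding_pair p D Q"
  shows "\<not> isometric_subgraph (sub_graph (gadget K p D Q)) (host_graph (gadget K p D Q))"
proof
  define h where "h = core_size p D"
  let ?G = "host_graph (gadget K p D Q)" and ?H = "sub_graph (gadget K p D Q)"
  assume iso: "isometric_subgraph ?H ?G"
  obtain i j where ij: "i < p" "j < p" and avoid: "\<And>k. k < D \<Longrightarrow> \<not> (Q i k \<and> Q (p + j) k)"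
    using ex unfolding avoiding_pair_def by blast
  \<comment> \<open>A function that changes by at most 1 along each core edge and separates the two ports by 5.\<close>
  define f where "f v =
      (if v < p then if v = i then 0 else 2
       else if v < 2 * p then if v = p + j then 5 else 3
       else if v = 2 * p then 1 else if v = 2 * p + 1 then 4
       else let k = (v - (2 * p + 2)) div 2 in
         if Q i k then 1 + v mod 2 else 3 + v mod 2)" for v :: nat
  have f_edge: "f u \<le> Suc (f v) \<and> f v \<le> Suc (f u)" if "(u, v) \<in> set (core_edges p D Q)" for u v
  proof -
    consider k where "k < D" "u = 2 * p + 2 + 2 * k" "v = 2 * p + 3 + 2 * k"
      | "u < 2 * p" "v = 2 * p + u div p"
      | k where "u < 2 * p" "k < D" "Q u k" "v = 2 * p + 2 + 2 * k + u div p"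
      using \<open>(u, v) \<in> _\<close> unfolding mem_core_edges by blast
    then show ?thesis
    proof cases
      case 1
      then have "v - (2 * p + 2) = 2 * k + 1" "u - (2 * p + 2) = 2 * k" by auto
      with 1 show ?thesis by (simp add: f_def Let_def)
    next
      case 2
      then show ?thesis using ij by (auto simp: f_def port_side)
    next
      case 3
      have "(2 * k + u div p) div 2 = k" using port_side_less[OF 3(1)] by simp
      moreover have "(2 * p + 2 + 2 * k + u div p) mod 2 = u div p"
        using port_side_less[OF 3(1)] mod2_shift[of "u div p" "p + 1 + k"] by (simp add: algebra_simps)
      ultimately have "f v = (if Q i k then 1 + u div p else 3 + u div p)"
        using port_side_less[OF 3(1)] by (auto simp: f_def 3(4) Let_def)
      \<comment> \<open>Here the avoidance is decisive: port \<open>p + j\<close>, with value 5,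
        meets only colours where port \<open>i\<close> has no one, and their odd vertices have value
        4.\<close>
      then show ?thesis using ij 3 avoid[of k] by (auto simp: f_def port_side)
    qed
  qed
  have fH: "f v \<le> Suc (f u)" if "{u, v} \<in> edges ?H" for u v
    using that f_edge[of u v] f_edge[of v u]
    by (auto simp: sub_graph_def gadget_def Let_def edge_in_image_iff)
  have "enat 5 \<le> gdist ?H i (p + j)"
    unfolding gdist_def
  proof (rule INF_greatest)
    fix q assume "q \<in> {q. is_path ?H i (p + j) q}"
    then have "f (p + j) \<le> f i + (length q - 1)"
      using potential_le_length[of q ?H f] fH by (auto simp: is_path_def)
    moreover have "f (p + j) = 5" "f i = 0" using ij by (auto simp: f_def)
    ultimately show "enat 5 \<le> enat (length q - 1)" by simp
  qed
  moreover have "gdist ?G i (p + j) \<le> enat 4"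
  proof -
    define w where "w = [i, h + 1 + i, h, h + 1 + (p + j), p + j]"
    have outer: "{t, h + 1 + t} \<in> edges ?G \<and> {h, h + 1 + t} \<in> edges ?G" if "t < 2 * p" for t
      using that by (auto simp: host_graph_def gadget_def Let_def edge_in_image_iff mem_bypass_edges h_def)
    have "lies_in w ?G"
      using outer[of i] outer[of "p + j"] ij
      by (auto simp: lies_in_iff w_def insert_commute)
        (auto simp: host_graph_def gadget_def Let_def h_def core_size_def)
    then show ?thesis using gdist_le_walk[of w ?G] by (simp add: w_def numeral_eq_Suc)
  qed
  moreover have "gdist ?G i (p + j) = gdist ?H i (p + j)"
  proof -
    have "i \<in> verts ?H" "p + j \<in> verts ?H"
      using ij by (auto simp: sub_graph_def gadget_def Let_def core_size_def)
    then show ?thesis using iso by (auto simp: isometric_subgraph_def)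
  qed
  ultimately have "enat 5 \<le> enat 4" by (metis order_trans)
  then show False by simp
qed

section \<open>Running programs\<close>

text \<open>Overflow blocks a derivation instead of wrapping around, so longer words change neither
  result nor time. The embedded decision procedure comes with a smaller word bound than the composed
  program has.\<close>

lemma exec_word_mono: "exec B c s t s' \<Longrightarrow> B \<le> B' \<Longrightarrow> exec B' c s t s'"
  by (induction rule: exec.induct) (auto intro: exec.intros simp del: One_nat_def)

section \<open>Relocating programs\<close>

fun shift :: "nat \<Rightarrow> com \<Rightarrow> com" where
  "shift d Skip = Skip"
| "shift d (Const r k) = Const (r + d) k"
| "shift d (Op f r x y) = Op f (r + d) (x + d) (y + d)"
| "shift d (Load r a x) = Load (r + d) (a + 1) (x + d)"
| "shift d (Store a x r) = Store (a + 1) (x + d) (r + d)"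
| "shift d (Seq c1 c2) = Seq (shift d c1) (shift d c2)"
| "shift d (IfNZ r c1 c2) = IfNZ (r + d) (shift d c1) (shift d c2)"
| "shift d (WhileNZ r c) = WhileNZ (r + d) (shift d c)"

definition shifted :: "nat \<Rightarrow> state \<Rightarrow> state \<Rightarrow> bool" where
  "shifted d s s' \<longleftrightarrow> (\<forall>r. fst s' (r + d) = fst s r) \<and> (\<forall>a. snd s' (a + 1) = snd s a)"

text \<open>Arrays move by exactly 1, so that array 1, written by the reduction, becomes the input
  array 0 of the relocated program, to which the original input is then invisible.\<close>

lemma exec_shift:
  "exec B c s t s' \<Longrightarrow> shifted d s u \<Longrightarrow> \<exists>u'. exec B (shift d c) u t u' \<and> shifted d s' u'"
proof (induction arbitrary: u rule: exec.induct)
  case (Skip s)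
  then show ?case by (intro exI[of _ u]) (simp add: exec.Skip del: One_nat_def)
next
  case (Const k r R M)
  obtain R1 M1 where u: "u = (R1, M1)" by fastforce
  show ?case unfolding u shift.simps
    by (rule exI, rule conjI, rule exec.Const) (use Const u in \<open>auto simp: shifted_def\<close>)
next
  case (Op f R x y r M)
  obtain R1 M1 where u: "u = (R1, M1)" by fastforce
  show ?case unfolding u shift.simps
    by (rule exI, rule conjI, rule exec.Op) (use Op u in \<open>auto simp: shifted_def\<close>)
next
  case (Load M a R x r)
  obtain R1 M1 where u: "u = (R1, M1)" by fastforce
  show ?case unfolding u shift.simps
    by (rule exI, rule conjI, rule exec.Load) (use Load u in \<open>auto simp: shifted_def\<close>)
next
  case (Store a x r R M)
  obtain R1 M1 where u: "u = (R1, M1)" by fastforce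
  show ?case unfolding u shift.simps
    by (rule exI, rule conjI, rule exec.Store) (use Store u in \<open>auto simp: shifted_def\<close>)
next
  case (Seq c1 s t1 s' c2 t2 s'')
  then show ?case by (metis exec.Seq shift.simps(6))
next
  case (IfTrue s r c1 t s' c2)
  then have "fst u (r + d) \<noteq> 0" by (auto simp: shifted_def)
  with IfTrue show ?case by (metis exec.IfTrue shift.simps(7))
next
  case (IfFalse s r c2 t s' c1)
  then have "fst u (r + d) = 0" by (auto simp: shifted_def)
  with IfFalse show ?case by (metis exec.IfFalse shift.simps(7))
next
  case (WhileFalse s r c)
  then have "fst u (r + d) = 0" by (auto simp: shifted_def)
  with WhileFalse show ?case by (metis exec.WhileFalse shift.simps(8))
next
  case (WhileTrue s r c t1 s' t2 s'')
  then have "fst u (r + d) \<noteq> 0" by (auto simp: shifted_def)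
  with WhileTrue show ?case by (metis exec.WhileTrue shift.simps(8))
qed

fun writes :: "com \<Rightarrow> nat set" where
  "writes Skip = {}"
| "writes (Const r k) = {r}"
| "writes (Op f r x y) = {r}"
| "writes (Load r a x) = {r}"
| "writes (Store a x r) = {}"
| "writes (Seq c1 c2) = writes c1 \<union> writes c2"
| "writes (IfNZ r c1 c2) = writes c1 \<union> writes c2"
| "writes (WhileNZ r c) = writes c"

lemma exec_frame: "exec B c s t s' \<Longrightarrow> r \<notin> writes c \<Longrightarrow> fst s' r = fst s r"
  by (induction rule: exec.induct) auto

section \<open>Hoare triples with time bounds\<close>

definition runs :: "nat \<Rightarrow> com \<Rightarrow> state \<Rightarrow> nat \<Rightarrow> (state \<Rightarrow> bool) \<Rightarrow> bool" where
  "runs B c s t Q \<longleftrightarrow> (\<exists>t' s'. exec B c s t' s' \<and> t' \<le> t \<and> Q s')"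

lemma runs_mono: "runs B c s t Q \<Longrightarrow> t \<le> t' \<Longrightarrow> (\<And>s'. Q s' \<Longrightarrow> Q' s') \<Longrightarrow> runs B c s t' Q'"
  unfolding runs_def by (meson order_trans)

text \<open>Specifications thus describe only what changes; that other registers keep their values
  is read off the syntax.\<close>

lemma runs_frame:
  assumes "runs B c s t Q"
  shows "runs B c s t (\<lambda>s'. Q s' \<and> (\<forall>r. r \<notin> writes c \<longrightarrow> fst s' r = fst s r))"
  using assms exec_frame unfolding runs_def by metis

lemma runs_Seq:
  assumes "runs B c1 s t1 Q1" "\<And>s'. Q1 s' \<Longrightarrow> runs B c2 s' t2 Q"
  shows "runs B (Seq c1 c2) s (t1 + t2) Q"
  using assms exec.Seq[of B c1 s] add_mono unfolding runs_def by metis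

lemma runs_Skip: "Q s \<Longrightarrow> runs B Skip s 1 Q"
  unfolding runs_def using exec.Skip by blast

lemma runs_Const: "k < B \<Longrightarrow> Q (R(r := k), M) \<Longrightarrow> runs B (Const r k) (R, M) 1 Q"
  unfolding runs_def using exec.Const by blast

lemma runs_Op:
  "eval_op f (R x) (R y) < B \<Longrightarrow> Q (R(r := eval_op f (R x) (R y)), M) \<Longrightarrow>
    runs B (Op f r x y) (R, M) 1 Q"
  unfolding runs_def using exec.Op by blast

lemma runs_Load:
  "M a (R x) < B \<Longrightarrow> Q (R(r := M a (R x)), M) \<Longrightarrow> runs B (Load r a x) (R, M) 1 Q"
  unfolding runs_def using exec.Load by blast

lemma runs_Store: "Q (R, M(a := (M a)(R x := R r))) \<Longrightarrow> runs B (Store a x r) (R, M) 1 Q"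
  unfolding runs_def using exec.Store by blast

lemma runs_IfNZ:
  assumes "R r \<noteq> 0 \<Longrightarrow> runs B c1 (R, M) t Q" "R r = 0 \<Longrightarrow> runs B c2 (R, M) t Q"
  shows "runs B (IfNZ r c1 c2) (R, M) (Suc t) Q"
  using assms unfolding runs_def by (metis exec.IfFalse exec.IfTrue fst_conv not_less_eq_eq)

text \<open>The bound has the form \<open>Suc t\<close>, so repeated introduction counts the
  instructions by itself. Numerals are reached afterwards with \<open>runs_mono\<close>.\<close>

lemma runs_Seq_unit:
  assumes "exec B c1 s 1 s'" "runs B c2 s' t Q"
  shows "runs B (Seq c1 c2) s (Suc t) Q"
proof -
  obtain t2 s2 where "exec B c2 s' t2 s2" "t2 \<le> t" "Q s2" using assms(2) by (auto simp: runs_def)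
  moreover from this(1) have "exec B (Seq c1 c2) s (1 + t2) s2" by (rule exec.Seq[OF assms(1)])
  ultimately show ?thesis
    unfolding runs_def by (intro exI[of _ "1 + t2"] exI[of _ s2]) simp
qed

lemma runs_Seq_Const:
  "k < B \<Longrightarrow> runs B c (R(r := k), M) t Q \<Longrightarrow> runs B (Seq (Const r k) c) (R, M) (Suc t) Q"
  using exec.Const by (rule runs_Seq_unit)

lemma runs_Seq_Op:
  "eval_op f (R x) (R y) < B \<Longrightarrow> runs B c (R(r := eval_op f (R x) (R y)), M) t Q \<Longrightarrow>
    runs B (Seq (Op f r x y) c) (R, M) (Suc t) Q"
  using exec.Op by (rule runs_Seq_unit)

lemma runs_Seq_Load:
  "M a (R x) < B \<Longrightarrow> runs B c (R(r := M a (R x)), M) t Q \<Longrightarrow>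
    runs B (Seq (Load r a x) c) (R, M) (Suc t) Q"
  using exec.Load by (rule runs_Seq_unit)

lemma runs_Seq_Store:
  "runs B c (R, M(a := (M a)(R x := R r))) t Q \<Longrightarrow>
    runs B (Seq (Store a x r) c) (R, M) (Suc t) Q"
  using exec.Store by (rule runs_Seq_unit)

lemmas runs_line = runs_Seq_Const runs_Seq_Op runs_Seq_Load runs_Seq_Store
  runs_Const runs_Op runs_Load runs_Store

section \<open>Counting loops\<close>

definition For :: "nat \<Rightarrow> nat \<Rightarrow> nat \<Rightarrow> com \<Rightarrow> com" where
  "For i n c body = Seq (Const i 0) (Seq (Op OpLess c i n)
     (WhileNZ c (Seq body (Seq (Const c 1) (Seq (Op OpAdd i i c) (Op OpLess c i n))))))"

lemma writes_For [simp]: "writes (For i n c body) = {i, c} \<union> writes body"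
  by (auto simp: For_def)

text \<open>A round costs the body, three instructions of bookkeeping and the loop test; the two
  initial instructions and the last test give the 3. The invariant may not depend on
  \<open>i\<close> and \<open>c\<close>, which are overwritten between rounds: \<open>c\<close>
  serves both as the increment 1 and as the loop flag.\<close>

lemma runs_For:
  assumes regs: "i \<noteq> n" "c \<noteq> n" "i \<noteq> c" "i \<notin> writes body" "n \<notin> writes body"
    and N: "R n = N" "N < B" "1 < B"
    and init: "I 0 R M"
    and stable: "\<And>j R R' M. I j R M \<Longrightarrow> (\<And>r. r \<noteq> i \<Longrightarrow> r \<noteq> c \<Longrightarrow> R' r = R r) \<Longrightarrow> I j R' M"
    and step: "\<And>j R' M. \<lbrakk>j < N; I j R' M; R' i = j;
        \<And>r. r \<noteq> i \<Longrightarrow> r \<noteq> c \<Longrightarrow> r \<notin> writes body \<Longrightarrow> R' r = R r\<rbrakk> \<Longrightarrow>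
        runs B body (R', M) t (\<lambda>(R'', M''). I (Suc j) R'' M'')"
  shows "runs B (For i n c body) (R, M) (N * (t + 4) + 3) (\<lambda>(R', M'). I N R' M')"
proof -
  let ?rest = "Seq (Const c 1) (Seq (Op OpAdd i i c) (Op OpLess c i n))"
  \<comment> \<open>\<open>k\<close> is the number of rounds still to come, so the induction runs
    downwards in the counter.\<close>
  have loop: "runs B (WhileNZ c (Seq body ?rest)) (R', M') (k * (t + 4) + 1) (\<lambda>(R', M'). I N R' M')"
    if "k \<le> N" "I (N - k) R' M'" "R' i = N - k" "R' c = of_bool (0 < k)"
      "\<And>r. r \<noteq> i \<Longrightarrow> r \<noteq> c \<Longrightarrow> r \<notin> writes body \<Longrightarrow> R' r = R r" for k R' M'
    using that
  proof (induction k arbitrary: R' M')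
    case 0
    then have "exec B (WhileNZ c (Seq body ?rest)) (R', M') 1 (R', M')"
      by (intro exec.WhileFalse) auto
    with 0 show ?case by (auto simp: runs_def)
  next
    case (Suc k)
    let ?Q = "\<lambda>(R'', M''). I (N - k) R'' M'' \<and> R'' i = N - k \<and> R'' c = of_bool (0 < k) \<and>
       (\<forall>r. r \<noteq> i \<longrightarrow> r \<noteq> c \<longrightarrow> r \<notin> writes body \<longrightarrow> R'' r = R r)"
    have sk: "Suc (N - Suc k) = N - k" using Suc.prems(1) by simp
    have "runs B body (R', M') t (\<lambda>(R'', M''). I (Suc (N - Suc k)) R'' M'')"
      by (rule step) (use Suc.prems in auto)
    from runs_frame[OF this] have "runs B (Seq body ?rest) (R', M') (t + 3) ?Q"
    proof (rule runs_Seq)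
      fix s' assume s': "(case s' of (R'', M'') \<Rightarrow> I (Suc (N - Suc k)) R'' M'') \<and>
        (\<forall>r. r \<notin> writes body \<longrightarrow> fst s' r = fst (R', M') r)"
      obtain R2 M2 where [simp]: "s' = (R2, M2)" by fastforce
      have R2: "R2 i = N - Suc k" "R2 n = N"
        and R2_frame: "\<And>r. r \<noteq> i \<Longrightarrow> r \<noteq> c \<Longrightarrow> r \<notin> writes body \<Longrightarrow> R2 r = R r"
        using s' regs Suc.prems N by auto
      have "I (N - k) R2 M2" using s' sk by simp
      then have I: "I (N - k) (R2(c := 1, i := N - k, c := of_bool (0 < k))) M2"
        by (rule stable) auto
      have "runs B ?rest (R2, M2) (Suc (Suc 1)) ?Q"
        using N R2 regs Suc.prems(1) R2_frame I sk
        by (intro runs_line) (auto simp: Suc_diff_Suc)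
      then show "runs B ?rest s' 3 ?Q"
        unfolding \<open>s' = (R2, M2)\<close> by (rule runs_mono) simp_all
    qed
    then obtain t1 s1 where t1: "exec B (Seq body ?rest) (R', M') t1 s1" "t1 \<le> t + 3" "?Q s1"
      unfolding runs_def by blast
    obtain R1 M1 where s1: "s1 = (R1, M1)" by fastforce
    have "runs B (WhileNZ c (Seq body ?rest)) (R1, M1) (k * (t + 4) + 1) (\<lambda>(R', M'). I N R' M')"
      by (rule Suc.IH) (use t1(3) s1 Suc.prems(1) in auto)
    then obtain t2 s2 where t2: "exec B (WhileNZ c (Seq body ?rest)) s1 t2 s2"
        "t2 \<le> k * (t + 4) + 1" "case s2 of (R', M') \<Rightarrow> I N R' M'"
      unfolding runs_def s1 by blast
    have "exec B (WhileNZ c (Seq body ?rest)) (R', M') (Suc (t1 + t2)) s2"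
      using Suc.prems(4) t1(1) t2(1) by (intro exec.WhileTrue) auto
    then show ?case
      unfolding runs_def by (intro exI[of _ "Suc (t1 + t2)"] exI[of _ s2]) (use t1(2) t2(2,3) in simp)
  qed
  have "runs B (WhileNZ c (Seq body ?rest)) (R(i := 0, c := of_bool (0 < N)), M) (N * (t + 4) + 1)
      (\<lambda>(R', M'). I N R' M')"
    using regs N by (intro loop) (auto intro: stable[OF init])
  then have "runs B (For i n c body) (R, M) (Suc (Suc (N * (t + 4) + 1))) (\<lambda>(R', M'). I N R' M')"
    unfolding For_def using regs N by (intro runs_Seq_Const runs_Seq_Op) auto
  then show ?thesis by (rule runs_mono) simp_all
qed

section \<open>Programs appending to an array\<close>

definition arr :: "nat list \<Rightarrow> nat \<Rightarrow> nat" where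
  "arr xs i = (if i < length xs then xs ! i else 0)"

text \<open>Array 0 holds the input and array 1 the output written so far; register 1 is its length.\<close>

definition mem :: "(nat \<Rightarrow> nat) \<Rightarrow> nat list \<Rightarrow> nat \<Rightarrow> nat \<Rightarrow> nat" where
  "mem A ys a = (if a = 0 then A else if a = 1 then arr ys else (\<lambda>_. 0))"

lemma init_state_mem: "init_state xs = ((\<lambda>_. 0), mem (arr xs) [])"
  by (auto simp: init_state_def mem_def arr_def fun_eq_iff)

lemma mem_append: "(mem A ys)(1 := (mem A ys 1)(length ys := v)) = mem A (ys @ [v])"
  by (auto simp: mem_def arr_def fun_eq_iff nth_append)

definition Emit :: "nat \<Rightarrow> com" where
  "Emit r = Seq (Store 1 1 r) (Seq (Const 10 1) (Op OpAdd 1 1 10))"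

lemma writes_Emit [simp]: "writes (Emit r) = {1, 10}"
  by (auto simp: Emit_def)

text \<open>The quantification over the earlier output \<open>ys\<close> makes specifications
  compose by concatenation. The condition \<open>pre\<close> sees registers only, since array 0 is
  fixed to \<open>A\<close> and the rest is determined by the output.\<close>

definition emits :: "nat \<Rightarrow> (nat \<Rightarrow> nat) \<Rightarrow> ((nat \<Rightarrow> nat) \<Rightarrow> bool) \<Rightarrow> com \<Rightarrow> nat \<Rightarrow> nat list \<Rightarrow> bool"
  where "emits B A pre c t xs \<longleftrightarrow>
    (\<forall>R ys. pre R \<and> R 1 = length ys \<and> length ys + length xs < B \<and> 1 < B \<longrightarrow>
      runs B c (R, mem A ys) t (\<lambda>(R', M'). M' = mem A (ys @ xs) \<and> R' 1 = length ys + length xs))"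

definition stable :: "((nat \<Rightarrow> nat) \<Rightarrow> bool) \<Rightarrow> nat set \<Rightarrow> bool" where
  "stable pre S \<longleftrightarrow> (\<forall>R R'. pre R \<longrightarrow> (\<forall>r. r \<notin> S \<longrightarrow> R' r = R r) \<longrightarrow> pre R')"

lemma emitsD:
  assumes "emits B A pre c t xs" "pre R" "R 1 = length ys" "length ys + length xs < B" "1 < B"
  shows "runs B c (R, mem A ys) t (\<lambda>(R', M'). M' = mem A (ys @ xs) \<and> R' 1 = length ys + length xs
    \<and> (\<forall>r. r \<notin> writes c \<longrightarrow> R' r = R r))"
proof -
  have "runs B c (R, mem A ys) t (\<lambda>(R', M'). M' = mem A (ys @ xs) \<and> R' 1 = length ys + length xs)"
    using assms unfolding emits_def by blast
  from runs_frame[OF this] show ?thesis by (rule runs_mono) auto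
qed

lemma emits_mono_time: "emits B A pre c t xs \<Longrightarrow> t \<le> t' \<Longrightarrow> emits B A pre c t' xs"
  unfolding emits_def by (blast intro: runs_mono)

lemma emits_weaken:
  "emits B A pre c t xs \<Longrightarrow> (\<And>R. pre' R \<Longrightarrow> pre R) \<Longrightarrow> emits B A pre' c t xs"
  by (auto simp: emits_def)

lemma emits_Emit:
  assumes "\<And>R. pre R \<Longrightarrow> R r = v"
  shows "emits B A pre (Emit r) 3 [v]"
  unfolding emits_def Emit_def
proof (intro allI impI, elim conjE)
  fix R and ys :: "nat list" assume *: "pre R" "R 1 = length ys" "length ys + length [v] < B" "1 < B"
  have "runs B (Seq (Store 1 1 r) (Seq (Const 10 1) (Op OpAdd 1 1 10))) (R, mem A ys) (Suc (Suc 1))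
      (\<lambda>(R', M'). M' = mem A (ys @ [v]) \<and> R' 1 = length ys + length [v])"
    using * assms[OF *(1)] mem_append[of A ys v] by (intro runs_line) auto
  then show "runs B (Seq (Store 1 1 r) (Seq (Const 10 1) (Op OpAdd 1 1 10))) (R, mem A ys) 3
      (\<lambda>(R', M'). M' = mem A (ys @ [v]) \<and> R' 1 = length ys + length [v])"
    by (rule runs_mono) simp_all
qed

lemma emits_Skip: "emits B A pre Skip 1 []"
  unfolding emits_def by (intro allI impI runs_Skip) simp

lemma emits_Seq:
  assumes "emits B A pre c1 t1 xs" "emits B A pre c2 t2 ys" "stable pre (writes c1)"
  shows "emits B A pre (Seq c1 c2) (t1 + t2) (xs @ ys)"
  unfolding emits_def
proof (intro allI impI, elim conjE)
  fix R and zs :: "nat list" assume *: "pre R" "R 1 = length zs" "length zs + length (xs @ ys) < B" "1 < B"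
  have "runs B c1 (R, mem A zs) t1 (\<lambda>(R', M'). M' = mem A (zs @ xs) \<and>
      R' 1 = length zs + length xs \<and> (\<forall>r. r \<notin> writes c1 \<longrightarrow> R' r = R r))"
    using * by (intro emitsD[OF assms(1)]) auto
  then show "runs B (Seq c1 c2) (R, mem A zs) (t1 + t2) (\<lambda>(R', M'). M' = mem A (zs @ xs @ ys) \<and>
      R' 1 = length zs + length (xs @ ys))"
  proof (rule runs_Seq, clarify)
    fix R' assume R': "R' 1 = length zs + length xs" "\<forall>r. r \<notin> writes c1 \<longrightarrow> R' r = R r"
    then have "pre R'" using assms(3) *(1) unfolding stable_def by blast
    then show "runs B c2 (R', mem A (zs @ xs)) t2 (\<lambda>(R', M'). M' = mem A (zs @ xs @ ys) \<and>
      R' 1 = length zs + length (xs @ ys))"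
      by (intro runs_mono[OF emitsD[OF assms(2)]]) (use R' * in auto)
  qed
qed

text \<open>Counterpart of \<open>emits_Seq\<close> for a silent first part, which appends nothing
  but computes the registers described by \<open>pre'\<close>.\<close>

lemma emits_after:
  assumes "\<And>R ys. pre R \<Longrightarrow> runs B c1 (R, mem A ys) t1 (\<lambda>(R', M'). M' = mem A ys \<and> pre' R')"
    and "emits B A pre' c2 t2 xs" "1 \<notin> writes c1"
  shows "emits B A pre (Seq c1 c2) (t1 + t2) xs"
  unfolding emits_def
proof (intro allI impI, elim conjE)
  fix R and ys :: "nat list" assume *: "pre R" "R 1 = length ys" "length ys + length xs < B" "1 < B"
  from runs_frame[OF assms(1)[OF *(1)], of ys]
  show "runs B (Seq c1 c2) (R, mem A ys) (t1 + t2) (\<lambda>(R', M'). M' = mem A (ys @ xs) \<and>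
      R' 1 = length ys + length xs)"
    by (rule runs_Seq) (use assms(2,3) * in \<open>auto simp: emits_def\<close>)
qed

lemma emits_IfNZ:
  assumes "\<And>R. pre R \<Longrightarrow> R r \<noteq> 0 \<longleftrightarrow> b"
    and "b \<Longrightarrow> emits B A pre c1 t xs" "\<not> b \<Longrightarrow> emits B A pre c2 t ys"
  shows "emits B A pre (IfNZ r c1 c2) (Suc t) (if b then xs else ys)"
  unfolding emits_def
proof (intro allI impI runs_IfNZ, elim conjE, goal_cases)
  case (1 R zs)
  then show ?case using assms(1)[of R] assms(2) by (auto simp: emits_def)
next
  case (2 R zs)
  then show ?case using assms(1)[of R] assms(3) by (auto simp: emits_def)
qed

lemma length_concat_map_upt_le:
  "i \<le> n \<Longrightarrow> length (concat (map f [0..<i])) \<le> length (concat (map f [0..<n]))"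
  by (induction n) (auto simp: le_Suc_eq)

lemma emits_For:
  assumes regs: "i \<noteq> n" "c \<noteq> n" "i \<noteq> c" "i \<notin> writes body" "n \<notin> writes body" "i \<noteq> 1" "c \<noteq> 1"
    and N: "\<And>R. pre R \<Longrightarrow> R n = N" "N < B"
    and st: "stable pre ({i, c} \<union> writes body)"
    and body: "\<And>j. j < N \<Longrightarrow> emits B A (\<lambda>R. pre R \<and> R i = j) body t (f j)"
  shows "emits B A pre (For i n c body) (N * (t + 4) + 3) (concat (map f [0..<N]))"
  unfolding emits_def
proof (intro allI impI, elim conjE)
  fix R and ys :: "nat list" assume *: "pre R" "R 1 = length ys" "length ys + length (concat (map f [0..<N])) < B" "1 < B"
  let ?I = "\<lambda>j R M. M = mem A (ys @ concat (map f [0..<j])) \<and>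
    R 1 = length ys + length (concat (map f [0..<j]))"
  have "runs B (For i n c body) (R, mem A ys) (N * (t + 4) + 3) (\<lambda>(R', M'). ?I N R' M')"
  proof (rule runs_For[where I = ?I], goal_cases)
    case (11 j R' M')
    have "pre R'" using st *(1) 11(4) unfolding stable_def by (metis Un_iff insert_iff)
    \<comment> \<open>The length register must fit into a word after each round: a prefix of the
      output is no longer than the whole.\<close>
    moreover have "length (concat (map f [0..<Suc j])) \<le> length (concat (map f [0..<N]))"
      using 11(1) by (intro length_concat_map_upt_le) simp
    ultimately have "runs B body (R', mem A (ys @ concat (map f [0..<j]))) t
      (\<lambda>(R'', M''). M'' = mem A ((ys @ concat (map f [0..<j])) @ f j) \<and>
        R'' 1 = length (ys @ concat (map f [0..<j])) + length (f j) \<and>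
        (\<forall>r. r \<notin> writes body \<longrightarrow> R'' r = R' r))"
      using 11(2,3) * by (intro emitsD[OF body[OF 11(1)]]) auto
    then show ?case using 11(2) by (elim conjE, simp only:) (erule runs_mono; auto)
  qed (use regs N * in auto)
  then show "runs B (For i n c body) (R, mem A ys) (N * (t + 4) + 3)
      (\<lambda>(R', M'). M' = mem A (ys @ concat (map f [0..<N])) \<and>
        R' 1 = length ys + length (concat (map f [0..<N])))" .
qed

section \<open>A program writing the reduction graph\<close>

definition flat :: "(nat \<times> nat) list \<Rightarrow> nat list" where
  "flat es = concat (map (\<lambda>(u, v). [u, v]) es)"

lemma flat_simps [simp]:
  "flat [] = []" "flat ((u, v) # es) = u # v # flat es" "flat (es @ fs) = flat es @ flat fs"
  by (auto simp: flat_def)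

lemma flat_concat_map: "flat (concat (map f xs)) = concat (map (\<lambda>x. flat (f x)) xs)"
  by (induction xs) auto

lemma length_flat [simp]: "length (flat es) = 2 * length es"
  by (induction es) auto

text \<open>Register 17 is left to the program that reads the predicate \<open>Q\<close> from the input.\<close>

definition env :: "nat \<Rightarrow> nat \<Rightarrow> nat \<Rightarrow> (nat \<Rightarrow> nat) \<Rightarrow> bool" where
  "env p D b R \<longleftrightarrow> R 3 = p \<and> R 4 = D \<and> R 5 = 2 * p \<and> R 11 = 2 * p + 2 \<and>
     R 12 = core_size p D \<and> R 13 = core_size p D + 1 \<and> R 17 = b"

definition emit_core :: "com \<Rightarrow> com" where
  "emit_core q = Seq
     (For 7 4 9 (Seq
        (Seq (Op OpAdd 8 11 7) (Seq (Op OpAdd 8 8 7) (Seq (Const 10 1) (Op OpAdd 18 8 10))))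
        (Seq (Emit 8) (Emit 18))))
     (For 6 5 19 (Seq
        (Seq (Op OpDiv 14 6 3) (Op OpAdd 8 5 14))
        (Seq (Seq (Emit 6) (Emit 8))
          (For 7 4 9 (Seq
            (Seq q (Seq (Op OpAdd 8 11 7) (Seq (Op OpAdd 8 8 7) (Op OpAdd 8 8 14))))
            (IfNZ 15 (Seq (Emit 6) (Emit 8)) Skip))))))"

definition emit_bypass :: com where
  "emit_bypass = For 6 5 19 (Seq (Op OpAdd 8 13 6)
     (Seq (Seq (Emit 6) (Emit 8)) (Seq (Emit 12) (Emit 8))))"

definition write_header :: "nat \<Rightarrow> com" where
  "write_header K = Seq (Op OpAdd 8 5 5) (Seq (Op OpAdd 8 16 8) (Seq (Const 9 K) (Seq (Op OpMul 9 8 9)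
     (Seq (Op OpAdd 9 9 13) (Seq (Op OpAdd 9 9 5)
     (Seq (Const 10 0) (Seq (Store 1 10 9) (Seq (Const 10 1) (Seq (Store 1 10 8)
     (Seq (Const 10 2) (Seq (Store 1 10 12) (Seq (Const 10 3) (Store 1 10 16)))))))))))))"

definition init_regs :: com where
  "init_regs = Seq (Op OpAdd 5 3 3) (Seq (Const 8 2) (Seq (Op OpAdd 11 5 8)
     (Seq (Op OpAdd 12 11 4) (Seq (Op OpAdd 12 12 4) (Seq (Const 8 1) (Op OpAdd 13 12 8))))))"

definition count_core :: com where
  "count_core = Seq (Const 8 4) (Seq (Op OpSub 16 1 8) (Seq (Const 8 2) (Op OpDiv 16 16 8)))"

text \<open>The header contains the number of core edges, known only once they have been written. So
  four zeros reserve its place, \<open>count_core\<close> recovers the number from the output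
  length, and the header is overwritten last. The core edges are emitted twice, as part of the edges
  of \<open>G\<close> and as the edges of \<open>H\<close>.\<close>

definition build :: "nat \<Rightarrow> com \<Rightarrow> com" where
  "build K q = Seq init_regs (Seq (Seq (Seq (Emit 0) (Emit 0)) (Seq (Seq (Emit 0) (Emit 0)) (emit_core q)))
     (Seq count_core (Seq (Seq emit_bypass (Seq (For 6 12 19 (Emit 6)) (emit_core q))) (write_header K))))"

lemma arr_header:
  "arr (a # b # c # d # ys) = (arr (0 # 0 # 0 # 0 # ys))(0 := a, 1 := b, 2 := c, 3 := d)"
  by (auto simp: arr_def fun_eq_iff nth_Cons split: nat.splits) 

lemma enc_graph_gadget:
  "enc_graph (gadget K p D Q) =
     fst (gadget K p D Q) # (length (core_edges p D Q) + 4 * p) # core_size p D # length (core_edges p D Q) #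
     flat (core_edges p D Q) @ flat (bypass_edges p D) @ [0..<core_size p D] @ flat (core_edges p D Q)"
  by (simp add: enc_graph_def gadget_def Let_def flat_def bypass_edges_def length_concat comp_def sum_list_triv)

section \<open>Size estimates for the gadget\<close>

lemma length_bypass_edges: "length (bypass_edges p D) = 4 * p"
  by (simp add: bypass_edges_def length_concat comp_def sum_list_triv)

lemma length_core_edges: "length (core_edges p D Q) \<le> D + 2 * p * (D + 1)"
proof -
  have row: "length (concat (map (\<lambda>k. if Q t k then [(t, f k)] else []) ks)) \<le> length ks"
    for t :: nat and f :: "nat \<Rightarrow> nat" and ks
    by (induction ks) auto
  have "length ((t, 2 * p + t div p) #
       concat (map (\<lambda>k. if Q t k then [(t, 2 * p + 2 + 2 * k + t div p)] else []) [0..<D])) \<le> D + 1" for t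
    using row[of t "\<lambda>k. 2 * p + 2 + 2 * k + t div p" "[0..<D]"] by simp
  then have "sum_list (map (\<lambda>t. length ((t, 2 * p + t div p) #
       concat (map (\<lambda>k. if Q t k then [(t, 2 * p + 2 + 2 * k + t div p)] else []) [0..<D]))) [0..<2*p])
     \<le> sum_list (map (\<lambda>t. D + 1) [0..<2*p])"
    by (intro sum_list_mono)
  then show ?thesis
    unfolding core_edges_def length_append length_concat map_map comp_def
    by (simp add: sum_list_triv)
qed

lemma fst_gadget:
  "fst (gadget K p D Q) = core_size p D + 1 + 2 * p + K * (length (core_edges p D Q) + 4 * p)"
  by (simp add: gadget_def Let_def length_bypass_edges)

text \<open>Makes all later estimates linear in the single quantity \<open>U\<close>. The added ones
  keep \<open>U\<close> positive when \<open>D\<close> or \<open>\<tau>\<close> is 0.\<close>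

lemma volume_bounds:
  fixes p D \<tau> :: nat
  defines "U \<equiv> p * (D + 1) * (\<tau> + 1)"
  assumes "0 < p"
  shows "p \<le> U" "D \<le> U" "1 \<le> U" "p * D \<le> U" "14 * D + 2 * p * (D * (\<tau> + 14) + 15) + 6 \<le> 80 * U"
    "length (core_edges p D Q) \<le> 5 * U" "core_size p D \<le> 6 * U"
proof -
  have U: "U = p * D * \<tau> + p * D + p * \<tau> + p" by (simp add: U_def algebra_simps)
  have D: "D \<le> p * D" using assms by simp
  have *: "2 * p * (D * (\<tau> + 14) + 15) = 2 * (p * D * \<tau>) + 28 * (p * D) + 30 * p"
    by (simp add: algebra_simps)
  have len: "length (core_edges p D Q) \<le> D + (2 * (p * D) + 2 * p)"
    using length_core_edges[of p D Q] by (simp add: algebra_simps)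
  \<comment> \<open>Naming the products leaves a problem of linear arithmetic.\<close>
  obtain d e g where deg: "p * D = d" "d * \<tau> = e" "p * \<tau> = g" by blast
  show "p \<le> U" "D \<le> U" "1 \<le> U" "p * D \<le> U" "14 * D + 2 * p * (D * (\<tau> + 14) + 15) + 6 \<le> 80 * U"
    "length (core_edges p D Q) \<le> 5 * U" "core_size p D \<le> 6 * U"
    using D assms(2) len unfolding * core_size_def U deg
    unfolding distrib_left by linarith+
qed

text \<open>The 9 collects at most \<open>5 * U\<close> core edges and \<open>4 * p\<close> bypass
  edges, each with \<open>K\<close> isolated vertices. The generous 300 is the time constant of
  \<open>build_runs\<close>, so that one expression serves as bound for size, time and
  words.\<close>

lemma gadget_size:
  assumes "0 < p"
  shows "fst (gadget K p D Q) \<le> (300 + 9 * K) * (p * (D + 1) * (\<tau> + 1))"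
proof -
  define U where "U = p * (D + 1) * (\<tau> + 1)"
  note vol = volume_bounds[OF assms, where D = D and \<tau> = \<tau>, folded U_def]
  have "K * (length (core_edges p D Q) + 4 * p) \<le> K * (9 * U)"
  proof (rule mult_left_mono)
    show "length (core_edges p D Q) + 4 * p \<le> 9 * U" using vol(1) vol(6)[of Q] by linarith
  qed simp
  moreover have "(300 + 9 * K) * U = 300 * U + K * (9 * U)" by (simp add: algebra_simps)
  ultimately show ?thesis using vol unfolding U_def[symmetric] fst_gadget by linarith
qed

text \<open>Both reductions differ only in how \<open>Q\<close> is read from the input, so the
  writer is verified once for an arbitrary query program \<open>q\<close>. Its registers stay below
  40, because the relocated decision procedure must find zeros from 40 on.\<close>

locale gadget_program =
  fixes B :: nat and A :: "nat \<Rightarrow> nat" and p D b :: nat and Q :: "nat \<Rightarrow> nat \<Rightarrow> bool"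
    and q :: com and \<tau> :: nat
  assumes B: "2 * p < B" "D < B" "core_size p D + 1 + 2 * p < B"
    and q_writes: "writes q \<subseteq> {15} \<union> {20..<40}"
    and q_runs: "\<And>R ys t k. env p D b R \<Longrightarrow> R 6 = t \<Longrightarrow> R 7 = k \<Longrightarrow> R 14 = t div p \<Longrightarrow>
      t < 2 * p \<Longrightarrow> k < D \<Longrightarrow>
      runs B q (R, mem A ys) \<tau> (\<lambda>(R', M'). M' = mem A ys \<and> R' 15 = of_bool (Q t k))"
begin

section \<open>Correctness and running time of the writing program\<close>

lemma B_gt_1: "1 < B" "2 < B"
  using B by (auto simp: core_size_def)

lemma q_frame: "r \<noteq> 15 \<Longrightarrow> r < 20 \<or> 40 \<le> r \<Longrightarrow> r \<notin> writes q"
  using q_writes by fastforce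

lemma emit_two:
  assumes "\<And>R. pre R \<Longrightarrow> R r = u" "\<And>R. pre R \<Longrightarrow> R r' = v" "stable pre {1, 10}"
  shows "emits B A pre (Seq (Emit r) (Emit r')) 6 [u, v]"
  using emits_Seq[OF emits_Emit[of pre r u] emits_Emit[of pre r' v]] assms by simp

lemma emits_colours:
  "emits B A (env p D b)
     (For 7 4 9 (Seq
        (Seq (Op OpAdd 8 11 7) (Seq (Op OpAdd 8 8 7) (Seq (Const 10 1) (Op OpAdd 18 8 10))))
        (Seq (Emit 8) (Emit 18)))) (D * 14 + 3)
     (flat (concat (map (\<lambda>k. [(2 * p + 2 + 2 * k, 2 * p + 3 + 2 * k)]) [0..<D])))"
proof -
  let ?pre = "\<lambda>k R. env p D b R \<and> R 7 = k \<and> R 8 = 2 * p + 2 + 2 * k \<and> R 18 = 2 * p + 3 + 2 * k"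
  have "emits B A (\<lambda>R. env p D b R \<and> R 7 = k) (Seq
        (Seq (Op OpAdd 8 11 7) (Seq (Op OpAdd 8 8 7) (Seq (Const 10 1) (Op OpAdd 18 8 10))))
        (Seq (Emit 8) (Emit 18))) (4 + 6) [2 * p + 2 + 2 * k, 2 * p + 3 + 2 * k]" if k: "k < D" for k
  proof (rule emits_after[where pre' = "?pre k"])
    fix R ys assume *: "env p D b R \<and> R 7 = k"
    have "runs B (Seq (Op OpAdd 8 11 7) (Seq (Op OpAdd 8 8 7) (Seq (Const 10 1) (Op OpAdd 18 8 10))))
        (R, mem A ys) (Suc (Suc (Suc 1))) (\<lambda>(R', M'). M' = mem A ys \<and> ?pre k R')"
      using * k B by (intro runs_line) (auto simp: env_def core_size_def)
    then show "runs B (Seq (Op OpAdd 8 11 7) (Seq (Op OpAdd 8 8 7) (Seq (Const 10 1) (Op OpAdd 18 8 10))))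
        (R, mem A ys) 4 (\<lambda>(R', M'). M' = mem A ys \<and> ?pre k R')" by (rule runs_mono) simp_all
  qed (auto intro!: emit_two simp: stable_def env_def)
  then have "emits B A (env p D b)
     (For 7 4 9 (Seq
        (Seq (Op OpAdd 8 11 7) (Seq (Op OpAdd 8 8 7) (Seq (Const 10 1) (Op OpAdd 18 8 10))))
        (Seq (Emit 8) (Emit 18)))) (D * (4 + 6 + 4) + 3)
     (concat (map (\<lambda>k. [2 * p + 2 + 2 * k, 2 * p + 3 + 2 * k]) [0..<D]))"
    using B by (intro emits_For) (auto simp: stable_def env_def)
  then show ?thesis unfolding flat_concat_map by simp
qed

lemma emits_port:
  assumes t: "t < 2 * p"
  shows "emits B A (\<lambda>R. env p D b R \<and> R 6 = t \<and> R 14 = t div p)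
    (For 7 4 9 (Seq
        (Seq q (Seq (Op OpAdd 8 11 7) (Seq (Op OpAdd 8 8 7) (Op OpAdd 8 8 14))))
        (IfNZ 15 (Seq (Emit 6) (Emit 8)) Skip))) (D * (\<tau> + 14) + 3)
    (flat (concat (map (\<lambda>k. if Q t k then [(t, 2 * p + 2 + 2 * k + t div p)] else []) [0..<D])))"
proof -
  let ?e = "\<lambda>R. env p D b R \<and> R 6 = t \<and> R 14 = t div p"
  let ?pre = "\<lambda>k R. ?e R \<and> R 8 = 2 * p + 2 + 2 * k + t div p \<and> R 15 = of_bool (Q t k)"
  have "emits B A (\<lambda>R. ?e R \<and> R 7 = k) (Seq
        (Seq q (Seq (Op OpAdd 8 11 7) (Seq (Op OpAdd 8 8 7) (Op OpAdd 8 8 14))))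
        (IfNZ 15 (Seq (Emit 6) (Emit 8)) Skip)) ((\<tau> + 3) + 7)
      (if Q t k then [t, 2 * p + 2 + 2 * k + t div p] else [])" if k: "k < D" for k
  proof (rule emits_after[where pre' = "?pre k"])
    fix R ys assume *: "?e R \<and> R 7 = k"
    have "runs B q (R, mem A ys) \<tau> (\<lambda>(R', M'). M' = mem A ys \<and> R' 15 = of_bool (Q t k))"
      using * t k by (intro q_runs) auto
    from runs_frame[OF this]
    show "runs B (Seq q (Seq (Op OpAdd 8 11 7) (Seq (Op OpAdd 8 8 7) (Op OpAdd 8 8 14))))
        (R, mem A ys) (\<tau> + 3) (\<lambda>(R', M'). M' = mem A ys \<and> ?pre k R')"
    proof (rule runs_Seq)
      fix s assume s: "(case s of (R', M') \<Rightarrow> M' = mem A ys \<and> R' 15 = of_bool (Q t k)) \<and>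
        (\<forall>r. r \<notin> writes q \<longrightarrow> fst s r = fst (R, mem A ys) r)"
      obtain R' M' where [simp]: "s = (R', M')" by fastforce
      have "env p D b R'" "R' 6 = t" "R' 14 = t div p" "R' 7 = k" "M' = mem A ys"
          "R' 15 = of_bool (Q t k)"
        using s * q_frame by (auto simp: env_def)
      then have "runs B (Seq (Op OpAdd 8 11 7) (Seq (Op OpAdd 8 8 7) (Op OpAdd 8 8 14)))
          (R', M') (Suc (Suc 1)) (\<lambda>(R', M'). M' = mem A ys \<and> ?pre k R')"
        using k B port_side_less[OF t] by (intro runs_line) (auto simp: env_def core_size_def)
      then show "runs B (Seq (Op OpAdd 8 11 7) (Seq (Op OpAdd 8 8 7) (Op OpAdd 8 8 14)))
          s 3 (\<lambda>(R', M'). M' = mem A ys \<and> ?pre k R')"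
        unfolding \<open>s = (R', M')\<close> by (rule runs_mono) simp_all
    qed
  next
    have "emits B A (?pre k) (IfNZ 15 (Seq (Emit 6) (Emit 8)) Skip) (Suc 6)
      (if Q t k then [t, 2 * p + 2 + 2 * k + t div p] else [])"
      by (intro emits_IfNZ emit_two emits_mono_time[OF emits_Skip])
        (auto simp: stable_def env_def)
    then show "emits B A (?pre k) (IfNZ 15 (Seq (Emit 6) (Emit 8)) Skip) 7
      (if Q t k then [t, 2 * p + 2 + 2 * k + t div p] else [])" by simp
  qed (use q_frame in auto)
  then have "emits B A ?e
    (For 7 4 9 (Seq
        (Seq q (Seq (Op OpAdd 8 11 7) (Seq (Op OpAdd 8 8 7) (Op OpAdd 8 8 14))))
        (IfNZ 15 (Seq (Emit 6) (Emit 8)) Skip))) (D * (\<tau> + 3 + 7 + 4) + 3)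
    (concat (map (\<lambda>k. if Q t k then [t, 2 * p + 2 + 2 * k + t div p] else []) [0..<D]))"
    using B q_frame by (intro emits_For) (auto simp: stable_def env_def)
  moreover have "flat (if Q t k then [(t, c)] else []) = (if Q t k then [t, c] else [])" for k c
    by simp
  ultimately show ?thesis unfolding flat_concat_map by (simp add: add.assoc)
qed

lemma emits_core:
  "emits B A (env p D b) (emit_core q) ((D * 14 + 3) + (2 * p * (D * (\<tau> + 14) + 15) + 3))
     (flat (core_edges p D Q))"
  unfolding emit_core_def core_edges_def flat_simps
proof (intro emits_Seq emits_colours)
  let ?hub = "Seq (Op OpDiv 14 6 3) (Op OpAdd 8 5 14)"
  let ?loop = "For 7 4 9 (Seq
        (Seq q (Seq (Op OpAdd 8 11 7) (Seq (Op OpAdd 8 8 7) (Op OpAdd 8 8 14))))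
        (IfNZ 15 (Seq (Emit 6) (Emit 8)) Skip))"
  let ?xs = "\<lambda>t. flat (concat (map (\<lambda>k. if Q t k then [(t, 2 * p + 2 + 2 * k + t div p)] else []) [0..<D]))"
  have "emits B A (\<lambda>R. env p D b R \<and> R 6 = t) (Seq ?hub (Seq (Seq (Emit 6) (Emit 8)) ?loop))
      (2 + (6 + (D * (\<tau> + 14) + 3))) ([t, 2 * p + t div p] @ ?xs t)" if t: "t < 2 * p" for t
  proof (rule emits_after[where pre' = "\<lambda>R. (env p D b R \<and> R 6 = t \<and> R 14 = t div p) \<and> R 8 = 2 * p + t div p"])
    fix R ys assume *: "env p D b R \<and> R 6 = t"
    have "runs B ?hub (R, mem A ys) (Suc 1) (\<lambda>(R', M'). M' = mem A ys \<and>
        (env p D b R' \<and> R' 6 = t \<and> R' 14 = t div p) \<and> R' 8 = 2 * p + t div p)"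
      using * t B port_side_less[OF t] by (intro runs_line) (auto simp: env_def core_size_def)
    then show "runs B ?hub (R, mem A ys) 2 (\<lambda>(R', M'). M' = mem A ys \<and>
        (env p D b R' \<and> R' 6 = t \<and> R' 14 = t div p) \<and> R' 8 = 2 * p + t div p)"
      by (rule runs_mono) simp_all
  next
    have "emits B A (\<lambda>R. (env p D b R \<and> R 6 = t \<and> R 14 = t div p) \<and> R 8 = 2 * p + t div p) ?loop
        (D * (\<tau> + 14) + 3) (?xs t)"
      using emits_port[OF t] by (simp add: emits_def)
    then show "emits B A (\<lambda>R. (env p D b R \<and> R 6 = t \<and> R 14 = t div p) \<and> R 8 = 2 * p + t div p)
      (Seq (Seq (Emit 6) (Emit 8)) ?loop) (6 + (D * (\<tau> + 14) + 3)) ([t, 2 * p + t div p] @ ?xs t)"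
      by (intro emits_Seq emit_two) (auto simp: stable_def env_def)
  qed auto
  then have "emits B A (env p D b) (For 6 5 19 (Seq ?hub (Seq (Seq (Emit 6) (Emit 8)) ?loop)))
      (2 * p * (2 + (6 + (D * (\<tau> + 14) + 3)) + 4) + 3)
      (concat (map (\<lambda>t. [t, 2 * p + t div p] @ ?xs t) [0..<2 * p]))"
    using B q_frame by (intro emits_For) (auto simp: stable_def env_def)
  moreover have "2 * p * (2 + (6 + (D * (\<tau> + 14) + 3)) + 4) + 3 = 2 * p * (D * (\<tau> + 14) + 15) + 3"
    by simp
  moreover have "flat (concat (map (\<lambda>t. (t, 2 * p + t div p) #
         concat (map (\<lambda>k. if Q t k then [(t, 2 * p + 2 + 2 * k + t div p)] else []) [0..<D]))
         [0..<2 * p])) = concat (map (\<lambda>t. [t, 2 * p + t div p] @ ?xs t) [0..<2 * p])"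
    by (subst flat_concat_map) simp
  ultimately show "emits B A (env p D b) (For 6 5 19 (Seq ?hub (Seq (Seq (Emit 6) (Emit 8)) ?loop)))
      (2 * p * (D * (\<tau> + 14) + 15) + 3)
      (flat (concat (map (\<lambda>t. (t, 2 * p + t div p) #
         concat (map (\<lambda>k. if Q t k then [(t, 2 * p + 2 + 2 * k + t div p)] else []) [0..<D]))
         [0..<2 * p])))"
    by (simp only:)
qed (auto simp: stable_def env_def)

lemma emits_bypass:
  "emits B A (env p D b) emit_bypass (2 * p * 17 + 3) (flat (bypass_edges p D))"
proof -
  let ?pre = "\<lambda>t R. (env p D b R \<and> R 6 = t) \<and> R 8 = core_size p D + 1 + t"
  have "emits B A (\<lambda>R. env p D b R \<and> R 6 = t) (Seq (Op OpAdd 8 13 6)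
     (Seq (Seq (Emit 6) (Emit 8)) (Seq (Emit 12) (Emit 8)))) (1 + (6 + 6))
     ([t, core_size p D + 1 + t] @ [core_size p D, core_size p D + 1 + t])" if t: "t < 2 * p" for t
  proof (rule emits_after[where pre' = "?pre t"])
    fix R ys assume "env p D b R \<and> R 6 = t"
    then show "runs B (Op OpAdd 8 13 6) (R, mem A ys) 1 (\<lambda>(R', M'). M' = mem A ys \<and> ?pre t R')"
      using B t by (intro runs_line) (auto simp: env_def)
  next
    show "emits B A (?pre t) (Seq (Seq (Emit 6) (Emit 8)) (Seq (Emit 12) (Emit 8))) (6 + 6)
      ([t, core_size p D + 1 + t] @ [core_size p D, core_size p D + 1 + t])"
      by (intro emits_Seq emit_two) (auto simp: stable_def env_def)
  qed auto
  then have "emits B A (env p D b) emit_bypass (2 * p * (1 + (6 + 6) + 4) + 3)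
    (concat (map (\<lambda>t. [t, core_size p D + 1 + t] @ [core_size p D, core_size p D + 1 + t]) [0..<2 * p]))"
    unfolding emit_bypass_def using B by (intro emits_For) (auto simp: stable_def env_def)
  then show ?thesis by (simp add: bypass_edges_def flat_concat_map)
qed

lemma emits_core_vertices:
  "emits B A (env p D b) (For 6 12 19 (Emit 6)) (core_size p D * 7 + 3) [0..<core_size p D]"
proof -
  have "emits B A (env p D b) (For 6 12 19 (Emit 6)) (core_size p D * (3 + 4) + 3)
      (concat (map (\<lambda>t. [t]) [0..<core_size p D]))"
    using B by (intro emits_For emits_Emit) (auto simp: stable_def env_def)
  then show ?thesis by simp
qed

lemma runs_init_regs:
  assumes "R 3 = p" "R 4 = D" "R 17 = b"
  shows "runs B init_regs (R, M) 7 (\<lambda>(R', M'). M' = M \<and> env p D b R')"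
proof -
  have "runs B init_regs (R, M) (Suc (Suc (Suc (Suc (Suc (Suc 1))))))
      (\<lambda>(R', M'). M' = M \<and> env p D b R')"
    unfolding init_regs_def using assms B by (intro runs_line) (auto simp: env_def core_size_def)
  then show ?thesis by (rule runs_mono) simp_all
qed

lemma runs_count_core:
  assumes "R 1 = 4 + 2 * l" "R 1 < B" "4 < B"
  shows "runs B count_core (R, M) 4 (\<lambda>(R', M'). M' = M \<and> R' 16 = l)"
proof -
  have "runs B count_core (R, M) (Suc (Suc (Suc 1))) (\<lambda>(R', M'). M' = M \<and> R' 16 = l)"
    unfolding count_core_def using assms by (intro runs_line) auto
  then show ?thesis by (rule runs_mono) simp_all
qed

lemma runs_write_header:
  assumes "env p D b R" "R 16 = l" "K < B" "l + 4 * p < B" "3 < B"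
    "core_size p D + 1 + 2 * p + K * (l + 4 * p) < B"
  shows "runs B (write_header K) (R, mem A (0 # 0 # 0 # 0 # ys)) 14 (\<lambda>(R', M'). M' = mem A
    ((core_size p D + 1 + 2 * p + K * (l + 4 * p)) # (l + 4 * p) # core_size p D # l # ys))"
proof -
  have [simp]: "R 5 = 2 * p" "R 12 = core_size p D" "R 13 = core_size p D + 1" "R 16 = l"
    using assms by (auto simp: env_def)
  have [simp]: "mem A zs 0 = A" "mem A zs (Suc 0) = arr zs" "j > 1 \<Longrightarrow> mem A zs j = (\<lambda>_. 0)" for zs j
    by (auto simp: mem_def)
  have mem_header: "(mem A (0 # 0 # 0 # 0 # ys))(Suc 0 := (arr (0 # 0 # 0 # 0 # ys))
      (0 := a, Suc 0 := b', 2 := c, 3 := d)) = mem A (a # b' # c # d # ys)" for a b' c d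
    using arr_header[of a b' c d ys] by (auto simp: mem_def)
  have "runs B (write_header K) (R, mem A (0 # 0 # 0 # 0 # ys))
    (Suc (Suc (Suc (Suc (Suc (Suc (Suc (Suc (Suc (Suc (Suc (Suc (Suc 1)))))))))))))
    (\<lambda>(R', M'). M' = mem A
    ((core_size p D + 1 + 2 * p + K * (l + 4 * p)) # (l + 4 * p) # core_size p D # l # ys))"
    unfolding write_header_def using assms
    by (intro runs_line) (auto simp: mem_header algebra_simps)
  then show ?thesis by (rule runs_mono) simp_all
qed

lemma build_runs:
  defines "U \<equiv> p * (D + 1) * (\<tau> + 1)"
  assumes p: "0 < p" and R: "R 0 = 0" "R 1 = 0" "R 3 = p" "R 4 = D" "R 17 = b"
    and K: "(300 + 9 * K) * U < B"
  shows "runs B (build K q) (R, mem A []) (300 * U)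
      (\<lambda>(R', M'). M' = mem A (enc_graph (gadget K p D Q)) \<and> (\<forall>r \<ge> 40. R' r = R r))"
proof -
  note vol = volume_bounds[OF p, where D = D and \<tau> = \<tau>, folded U_def]
  define cs where "cs = core_edges p D Q"
  define l where "l = length cs"
  define tc where "tc = (D * 14 + 3) + (2 * p * (D * (\<tau> + 14) + 15) + 3)"
  have B': "300 * U + 9 * (K * U) < B" using K by (simp add: algebra_simps)
  have KU: "K \<le> K * U" using vol(3) by simp
  have "K < B" using KU B' vol(3) by linarith
  have l: "l \<le> 5 * U" using vol by (simp add: l_def cs_def)
  have tc: "tc \<le> 80 * U" using vol by (simp add: tc_def)
  let ?xs = "[0, 0] @ [0, 0] @ flat cs"
  let ?ys = "flat (bypass_edges p D) @ [0..<core_size p D] @ flat cs"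
  let ?first = "Seq (Seq (Emit 0) (Emit 0)) (Seq (Seq (Emit 0) (Emit 0)) (emit_core q))"
  let ?second = "Seq emit_bypass (Seq (For 6 12 19 (Emit 6)) (emit_core q))"
  have core: "emits B A (env p D b) (emit_core q) tc (flat cs)"
    using emits_core by (simp add: tc_def cs_def)
  have w: "r \<notin> writes (emit_core q)" if "r \<notin> {1, 6, 7, 8, 9, 10, 14, 15, 18, 19}" "r < 20 \<or> 40 \<le> r" for r
    using q_frame[of r] that by (auto simp: emit_core_def)
  have w': "r \<notin> writes emit_bypass" if "r \<notin> {1, 6, 8, 10, 19}" for r
    using that by (auto simp: emit_bypass_def)
  have first: "emits B A (\<lambda>R. env p D b R \<and> R 0 = 0) ?first (6 + (6 + tc)) ?xs"
    by (intro emits_Seq emit_two emits_weaken[OF core]) (auto simp: stable_def env_def)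
  have second: "emits B A (env p D b) ?second ((2 * p * 17 + 3) + ((core_size p D * 7 + 3) + tc)) ?ys"
    by (intro emits_Seq core emits_bypass emits_core_vertices) (auto simp: stable_def env_def w')
  have "runs B (build K q) (R, mem A [])
    (7 + ((6 + (6 + tc)) + (4 + (((2 * p * 17 + 3) + ((core_size p D * 7 + 3) + tc)) + 14))))
    (\<lambda>(R', M'). M' = mem A (enc_graph (gadget K p D Q)))"
    unfolding build_def
  proof (rule runs_Seq[OF runs_frame[OF runs_init_regs[OF R(3-5)]]], clarify, goal_cases)
    case (1 R1 M1)
    have R1: "R1 0 = 0" "R1 1 = 0" using 1 R by (auto simp: init_regs_def)
    have "runs B ?first (R1, mem A []) (6 + (6 + tc)) (\<lambda>(R', M'). M' = mem A ([] @ ?xs) \<and>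
        R' 1 = length ([] :: nat list) + length ?xs \<and> (\<forall>r. r \<notin> writes ?first \<longrightarrow> R' r = R1 r))"
      using R1 1 B_gt_1 B' l vol(3) by (intro emitsD[OF first]) (auto simp: l_def)
    then show ?case
    proof (rule runs_Seq, clarify, goal_cases)
      case (1 R2 M2)
      have env2: "env p D b R2" using 1 \<open>env p D b R1\<close> by (auto simp: env_def w)
      have R2: "R2 1 = 4 + 2 * l" using 1 by (simp add: l_def)
      have "runs B count_core (R2, mem A ([] @ ?xs)) 4 (\<lambda>(R', M'). M' = mem A ([] @ ?xs) \<and> R' 16 = l)"
        using R2 B' l vol(3) by (intro runs_count_core) auto
      from runs_frame[OF this] show ?case
      proof (rule runs_Seq, clarify, goal_cases)
        case (1 R3 M3)
        have env3: "env p D b R3" and R3: "R3 1 = length ([] @ ?xs)" and "R3 16 = l"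
          using 1 env2 R2 by (auto simp: env_def count_core_def l_def)
        have "runs B ?second (R3, mem A ([] @ ?xs)) ((2 * p * 17 + 3) + ((core_size p D * 7 + 3) + tc))
          (\<lambda>(R', M'). M' = mem A (([] @ ?xs) @ ?ys) \<and> R' 1 = length ([] @ ?xs) + length ?ys \<and>
            (\<forall>r. r \<notin> writes ?second \<longrightarrow> R' r = R3 r))"
          using env3 R3 B_gt_1 B' l vol
          by (intro emitsD[OF second]) (auto simp: l_def length_bypass_edges)
        then show ?case
        proof (rule runs_Seq, clarify, goal_cases)
          case (1 R4 M4)
          have "env p D b R4" "R4 16 = l"
            using 1 env3 \<open>R3 16 = l\<close> by (auto simp: env_def w w')
          \<comment> \<open>The vertex count of \<open>G\<close> is the value for which the word
            bound contains \<open>9 * K\<close>.\<close>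
          moreover have "core_size p D + 1 + 2 * p + K * (l + 4 * p) < B"
            using le_less_trans[OF gadget_size[OF p] K[unfolded U_def]] by (simp add: fst_gadget l_def cs_def)
          ultimately have "runs B (write_header K) (R4, mem A (0 # 0 # 0 # 0 # (flat cs @ ?ys))) 14
            (\<lambda>(R', M'). M' = mem A ((core_size p D + 1 + 2 * p + K * (l + 4 * p)) #
              (l + 4 * p) # core_size p D # l # (flat cs @ ?ys)))"
            using B' \<open>K < B\<close> l vol by (intro runs_write_header) auto
          then show ?case by (simp add: enc_graph_gadget fst_gadget l_def cs_def)
        qed
      qed
    qed
  qed
  from runs_frame[OF this] show ?thesis
  proof (rule runs_mono)
    \<comment> \<open>Two passes over the core take at most \<open>160 * U\<close>, the bypasses
      \<open>34 * U\<close>, the vertex list \<open>42 * U\<close>, and the remaining 43 steps at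
      most \<open>43 * U\<close>.\<close>
    show "7 + ((6 + (6 + tc)) + (4 + (((2 * p * 17 + 3) + ((core_size p D * 7 + 3) + tc)) + 14))) \<le> 300 * U"
      using tc vol by linarith
    have "r \<notin> writes (build K q)" if "40 \<le> r" for r
      using that w[of r] w'[of r] by (auto simp: build_def init_regs_def count_core_def write_header_def)
    then show "case s' of (R', M') \<Rightarrow> M' = mem A (enc_graph (gadget K p D Q)) \<and> (\<forall>r\<ge>40. R' r = R r)"
      if "(case s' of (R', M') \<Rightarrow> M' = mem A (enc_graph (gadget K p D Q))) \<and>
        (\<forall>r. r \<notin> writes (build K q) \<longrightarrow> fst s' r = fst (R, mem A []) r)" for s'
      using that by auto
  qed
qed

end

section \<open>Orthogonal vectors\<close>

text \<open>The remainder gives both halves the same vectors, so pairs with equal indices are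
  covered, as \<open>has_orthogonal_pair\<close> demands.\<close>

definition ov_entry :: "nat list list \<Rightarrow> nat \<Rightarrow> nat \<Rightarrow> bool" where
  "ov_entry vs t k \<longleftrightarrow> vs ! (t mod length vs) ! k = 1"

text \<open>The vectors are stored row by row with width \<open>D\<close>; the constant 2 skips the
  header cells.\<close>

definition read_ov :: com where
  "read_ov = Seq (Op OpMod 20 6 3) (Seq (Op OpMul 20 20 4) (Seq (Const 21 2)
     (Seq (Op OpAdd 20 20 21) (Seq (Op OpAdd 20 20 7) (Load 15 0 20)))))"

lemma nth_concat_blocks:
  assumes "\<And>v. v \<in> set vs \<Longrightarrow> length v = D" "i < length vs" "k < D"
  shows "concat vs ! (i * D + k) = vs ! i ! k \<and> i * D + k < length (concat vs)"
  using assms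
proof (induction vs arbitrary: i)
  case (Cons v vs)
  then show ?case by (cases i) (auto simp: nth_append)
qed simp

lemma gadget_program_ov:
  assumes vs: "vs \<noteq> []" "\<And>v. v \<in> set vs \<Longrightarrow> length v = D" "\<And>v. v \<in> set vs \<Longrightarrow> set v \<subseteq> {0, 1}"
    and B: "(300 + 9 * K) * (length vs * (D + 1) * (6 + 1)) < B"
  shows "gadget_program B (arr (enc_ov vs)) (length vs) D 0 (ov_entry vs) read_ov 6"
proof
  define p where "p = length vs"
  have p: "0 < p" using vs by (simp add: p_def)
  have B7: "2100 * (p * D) + 2100 * p < B"
  proof -
    have "300 * (p * (D + 1) * 7) \<le> (300 + 9 * K) * (p * (D + 1) * 7)"
      by (intro mult_right_mono) auto
    also have "\<dots> < B" using B by (simp add: p_def)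
    finally show ?thesis by (simp add: algebra_simps)
  qed
  have D: "D \<le> p * D" using p by simp
  show "2 * length vs < B" "D < B" "core_size (length vs) D + 1 + 2 * length vs < B"
    using B7 D p unfolding p_def core_size_def by linarith+
  show "writes read_ov \<subseteq> {15} \<union> {20..<40}" by (auto simp: read_ov_def)
  fix R ys t k
  assume R: "env (length vs) D 0 R" "R 6 = t" "R 7 = k" "R 14 = t div length vs" and tk: "t < 2 * length vs" "k < D"
  define s where "s = t mod p"
  have s: "s < p" using p by (simp add: s_def)
  have "Suc s * D \<le> p * D" using s by (intro mult_right_mono) auto
  then have sD: "s * D + D \<le> p * D" by simp
  have nth: "arr (enc_ov vs) (s * D + 2 + k) = vs ! s ! k"
    using nth_concat_blocks[OF vs(2), where i = s and k = k] s tk by (auto simp: arr_def enc_ov_def p_def)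
  have "vs ! s \<in> set vs" using s by (simp add: p_def)
  then have "vs ! s ! k \<in> {0, 1}" using vs(2,3) tk nth_mem by blast
  then have entry: "vs ! s ! k = of_bool (ov_entry vs t k)" by (auto simp: ov_entry_def s_def p_def)
  have "runs B read_ov (R, mem (arr (enc_ov vs)) ys) (Suc (Suc (Suc (Suc (Suc 1)))))
     (\<lambda>(R', M'). M' = mem (arr (enc_ov vs)) ys \<and> R' 15 = of_bool (ov_entry vs t k))"
    unfolding read_ov_def
    using R s sD B7 p tk D nth entry
    by (intro runs_line) (auto simp: env_def mem_def p_def[symmetric] s_def[symmetric])
  then show "runs B read_ov (R, mem (arr (enc_ov vs)) ys) 6
     (\<lambda>(R', M'). M' = mem (arr (enc_ov vs)) ys \<and> R' 15 = of_bool (ov_entry vs t k))"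
    by (rule runs_mono) simp_all
qed

lemma avoiding_pair_ov:
  assumes "\<And>v. v \<in> set vs \<Longrightarrow> length v = D" "\<And>v. v \<in> set vs \<Longrightarrow> set v \<subseteq> {0, 1}"
  shows "avoiding_pair (length vs) D (ov_entry vs) \<longleftrightarrow> has_orthogonal_pair vs"
proof -
  have "inner_prod (vs ! i) (vs ! j) = 0 \<longleftrightarrow> (\<forall>k < D. \<not> (ov_entry vs i k \<and> ov_entry vs (length vs + j) k))"
    if ij: "i < length vs" "j < length vs" for i j
  proof -
    have mem: "vs ! i \<in> set vs" "vs ! j \<in> set vs" using ij by simp_all
    have bin: "vs ! i ! k = 0 \<or> vs ! i ! k = 1" "vs ! j ! k = 0 \<or> vs ! j ! k = 1" if "k < D" for k
      using mem assms that nth_mem by blast+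
    have "inner_prod (vs ! i) (vs ! j) = 0 \<longleftrightarrow> (\<forall>k < D. vs ! i ! k * vs ! j ! k = 0)"
      using assms(1)[OF mem(1)] by (auto simp: inner_prod_def)
    also have "\<dots> \<longleftrightarrow> (\<forall>k < D. \<not> (ov_entry vs i k \<and> ov_entry vs (length vs + j) k))"
    proof -
      have "vs ! i ! k * vs ! j ! k = 0 \<longleftrightarrow> \<not> (ov_entry vs i k \<and> ov_entry vs (length vs + j) k)"
        if "k < D" for k
        using bin[OF that] ij by (auto simp: ov_entry_def)
      then show ?thesis by blast
    qed
    finally show ?thesis .
  qed
  then show ?thesis unfolding avoiding_pair_def has_orthogonal_pair_def by blast
qed

section \<open>Satisfiability\<close>

definition enc_clause :: "literal list \<Rightarrow> nat list" where
  "enc_clause cl = length cl # map (\<lambda>(x, b). 2 * x + of_bool b) cl"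

text \<open>Clauses differ in length, so their addresses are prefix sums, which a query recomputes
  by scanning.\<close>

definition clause_pos :: "literal list list \<Rightarrow> nat \<Rightarrow> nat" where
  "clause_pos \<phi> j = 2 + length (concat (map enc_clause (take j \<phi>)))"

lemma enc_cnf_eq: "enc_cnf (n, \<phi>) = [n, length \<phi>] @ concat (map enc_clause \<phi>)"
  by (simp add: enc_cnf_def enc_clause_def[abs_def])

lemma clause_pos_Suc: "j < length \<phi> \<Longrightarrow> clause_pos \<phi> (Suc j) = clause_pos \<phi> j + (length (\<phi> ! j) + 1)"
  by (simp add: clause_pos_def take_Suc_conv_app_nth enc_clause_def)

lemma nth_enc_cnf:
  assumes "j < length \<phi>" "i \<le> length (\<phi> ! j)"
  shows "enc_cnf (n, \<phi>) ! (clause_pos \<phi> j + i) = enc_clause (\<phi> ! j) ! i"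
    and "clause_pos \<phi> j + i < length (enc_cnf (n, \<phi>))"
proof -
  have "concat (map enc_clause \<phi>) = concat (map enc_clause (take j \<phi>)) @ enc_clause (\<phi> ! j) @
      concat (map enc_clause (drop (Suc j) \<phi>))"
    by (subst id_take_nth_drop[OF assms(1)]) simp
  then have *: "enc_cnf (n, \<phi>) = ([n, length \<phi>] @ concat (map enc_clause (take j \<phi>))) @ enc_clause (\<phi> ! j) @
      concat (map enc_clause (drop (Suc j) \<phi>))" by (simp add: enc_cnf_eq)
  have "i < length (enc_clause (\<phi> ! j))" using assms(2) by (simp add: enc_clause_def)
  then show "enc_cnf (n, \<phi>) ! (clause_pos \<phi> j + i) = enc_clause (\<phi> ! j) ! i"
      "clause_pos \<phi> j + i < length (enc_cnf (n, \<phi>))"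
    unfolding * by (auto simp: clause_pos_def nth_append)
qed

text \<open>Half \<open>side \<in> {0, 1}\<close> consists of the variables \<open>side * b, \<dots>, side * b + b - 1\<close>, and bit \<open>y\<close> of
  the number \<open>s\<close> is the value of the variable \<open>side * b + y\<close>.\<close>

definition literal_holds :: "nat \<Rightarrow> nat \<Rightarrow> nat \<Rightarrow> literal \<Rightarrow> bool" where
  "literal_holds b side s = (\<lambda>(x, v). x div b = side \<and> bit s (x mod b) = v)"

definition clause_fails :: "nat \<Rightarrow> literal list list \<Rightarrow> nat \<Rightarrow> nat \<Rightarrow> bool" where
  "clause_fails b \<phi> t k \<longleftrightarrow> (\<forall>l \<in> set (\<phi> ! k). \<not> literal_holds b (t div 2 ^ b) (t mod 2 ^ b) l)"

section \<open>A program testing a clause against a half assignment\<close>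

definition skip_clause :: com where
  "skip_clause = Seq (Load 23 0 20) (Seq (Op OpAdd 20 20 23) (Seq (Const 23 1) (Op OpAdd 20 20 23)))"

text \<open>Register 20 points to the cell read last, at first the length cell of the clause, and is
  therefore advanced before loading.\<close>

definition decode_literal :: com where
  "decode_literal = Seq (Const 25 1) (Seq (Op OpAdd 20 20 25) (Seq (Load 26 0 20) (Seq (Const 25 2)
     (Seq (Op OpMod 27 26 25) (Op OpDiv 26 26 25)))))"

definition compare_bit :: com where
  "compare_bit = Seq (Op OpMod 26 26 17) (Seq (Op OpShr 26 24 26) (Seq (Op OpMod 26 26 25) (Op OpEq 26 26 27)))"

text \<open>Multiplication acts as conjunction of the two flags. Register 15 starts at 1 and is
  cleared as soon as a literal holds.\<close>

definition test_literal :: com where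
  "test_literal = Seq decode_literal (Seq (Seq (Op OpDiv 28 26 17) (Op OpEq 28 28 14))
     (Seq compare_bit (Seq (Op OpMul 28 28 26) (IfNZ 28 (Const 15 0) Skip))))"

lemma runs_decode_literal:
  assumes "R 20 = c" "M 0 (Suc c) = 2 * x + of_bool v" "Suc c < B" "2 * x + 1 < B" "2 < B"
  shows "runs B decode_literal (R, M) 6 (\<lambda>(R', M'). M' = M \<and> R' 20 = Suc c \<and> R' 25 = 2 \<and>
     R' 26 = x \<and> R' 27 = of_bool v)"
proof -
  have "runs B decode_literal (R, M) (Suc (Suc (Suc (Suc (Suc 1)))))
    (\<lambda>(R', M'). M' = M \<and> R' 20 = Suc c \<and> R' 25 = 2 \<and> R' 26 = x \<and> R' 27 = of_bool v)"
    unfolding decode_literal_def using assms by (intro runs_line) auto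
  then show ?thesis by (rule runs_mono) simp_all
qed

lemma runs_compare_bit:
  assumes "R 26 = x" "R 17 = b" "R 24 = s" "R 25 = 2" "R 27 = of_bool v" "x < B" "s < B" "2 < B"
  shows "runs B compare_bit (R, M) 4 (\<lambda>(R', M'). M' = M \<and> R' 26 = of_bool (bit s (x mod b) = v))"
proof -
  have "drop_bit k s < B" for k
    using assms(7) by (auto simp: drop_bit_eq_div intro: le_less_trans[OF div_le_dividend])
  moreover have "x mod b < B" using assms(6) by (rule le_less_trans[OF mod_less_eq_dividend])
  moreover have "drop_bit k s mod 2 = of_bool (bit s k)" for k
    by (simp add: bit_iff_odd_drop_bit mod_2_eq_odd)
  moreover have "(of_bool P = (of_bool P' :: nat)) = (P = P')" for P P' by auto
  ultimately have "runs B compare_bit (R, M) (Suc (Suc (Suc 1)))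
    (\<lambda>(R', M'). M' = M \<and> R' 26 = of_bool (bit s (x mod b) = v))"
    unfolding compare_bit_def using assms by (intro runs_line) auto
  then show ?thesis by (rule runs_mono) simp_all
qed

definition read_sat :: com where
  "read_sat = Seq (Const 20 2) (Seq (For 21 7 22 skip_clause)
     (Seq (Load 23 0 20) (Seq (Op OpMod 24 6 3) (Seq (Const 15 1) (For 21 23 22 test_literal)))))"

lemma runs_skip_clause:
  assumes "R 20 = clause_pos \<phi> j" "j < length \<phi>" "length (enc_cnf (n, \<phi>)) < B"
    "M 0 = arr (enc_cnf (n, \<phi>))" "1 < B"
  shows "runs B skip_clause (R, M) 4 (\<lambda>(R', M'). M' = M \<and> R' 20 = clause_pos \<phi> (Suc j))"
proof -
  let ?len = "length (\<phi> ! j)"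
  have "M 0 (clause_pos \<phi> j) = ?len" "clause_pos \<phi> j + ?len < B"
    using nth_enc_cnf[OF assms(2), of 0 n] nth_enc_cnf[OF assms(2), of ?len n] assms
    by (auto simp: arr_def enc_clause_def)
  moreover have "clause_pos \<phi> j + ?len + 1 < B"
    using nth_enc_cnf(2)[OF assms(2), of ?len n] assms by simp
  ultimately have "runs B skip_clause (R, M) (Suc (Suc (Suc 1)))
      (\<lambda>(R', M'). M' = M \<and> R' 20 = clause_pos \<phi> (Suc j))"
    unfolding skip_clause_def using assms clause_pos_Suc[OF assms(2)]
    by (intro runs_line) auto
  then show ?thesis by (rule runs_mono) simp_all
qed

lemma runs_test_literal:
  assumes R: "R 20 = c + i" "R 24 = s" "R 14 = side" "R 17 = b"
    and M: "M 0 (Suc (c + i)) = 2 * x + of_bool v" "Suc (c + i) < B" "2 * x + 1 < B" "s < B" "2 < B"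
  shows "runs B test_literal (R, M) 15 (\<lambda>(R', M'). M' = M \<and> R' 20 = c + Suc i \<and>
     R' 15 = (if literal_holds b side s (x, v) then 0 else R 15))"
proof -
  let ?cmp = "Seq (Op OpDiv 28 26 17) (Op OpEq 28 28 14)"
  let ?upd = "Seq (Op OpMul 28 28 26) (IfNZ 28 (Const 15 0) Skip)"
  have x: "x < B" "x div b < B" using M(3) le_less_trans[OF div_le_dividend, of x B b] by auto
  have "runs B test_literal (R, M) (6 + (2 + (4 + 3)))
     (\<lambda>(R', M'). M' = M \<and> R' 20 = c + Suc i \<and>
        R' 15 = (if literal_holds b side s (x, v) then 0 else R 15))"
    unfolding test_literal_def
  proof (rule runs_Seq[OF runs_frame[OF runs_decode_literal[of R "c + i" M x v B, OF R(1) M(1,2,3,5)]]], clarify, goal_cases)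
    case (1 R1 M1)
    have R1: "R1 20 = c + Suc i" "R1 25 = 2" "R1 26 = x" "R1 27 = of_bool v" "R1 24 = s" "R1 14 = side"
        "R1 17 = b" "R1 15 = R 15"
      using 1 R by (auto simp: decode_literal_def)
    have "runs B ?cmp (R1, M) (Suc 1) (\<lambda>(R', M'). M' = M \<and> R' 28 = of_bool (x div b = side))"
      using R1 x M by (intro runs_line) auto
    then have "runs B ?cmp (R1, M) 2 (\<lambda>(R', M'). M' = M \<and> R' 28 = of_bool (x div b = side))"
      by (rule runs_mono) simp_all
    from runs_frame[OF this] show ?case
    proof (rule runs_Seq, clarify, goal_cases)
      case (1 R2 M2)
      have R2: "R2 20 = c + Suc i" "R2 25 = 2" "R2 26 = x" "R2 27 = of_bool v" "R2 24 = s"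
          "R2 17 = b" "R2 15 = R 15" "R2 28 = of_bool (x div b = side)"
        using 1 R1 by auto
      have "runs B compare_bit (R2, M) 4 (\<lambda>(R', M'). M' = M \<and> R' 26 = of_bool (bit s (x mod b) = v))"
        using R2 x M by (intro runs_compare_bit) auto
      from runs_frame[OF this] show ?case
      proof (rule runs_Seq, clarify, goal_cases)
        case (1 R3 M3)
        have R3: "R3 20 = c + Suc i" "R3 15 = R 15" "R3 28 = of_bool (x div b = side)"
            "R3 26 = of_bool (bit s (x mod b) = v)"
          using 1 R2 by (auto simp: compare_bit_def)
        have "runs B ?upd (R3, M) (Suc (Suc 1)) (\<lambda>(R', M'). M' = M \<and> R' 20 = c + Suc i \<and>
          R' 15 = (if literal_holds b side s (x, v) then 0 else R 15))"
          using R3 M by (intro runs_line runs_IfNZ runs_Skip) (auto simp: literal_holds_def)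
        then show ?case by (rule runs_mono) (use R1(3) in auto)
      qed
    qed
  qed
  then show ?thesis by simp
qed

text \<open>Each query scans the formula anew. This costs a factor polynomial in the number of
  variables, harmless next to the exponential number of ports.\<close>

lemma runs_read_sat:
  assumes k: "k < length \<phi>" "length (\<phi> ! k) \<le> w"
    and lits: "\<And>x v. (x, v) \<in> set (\<phi> ! k) \<Longrightarrow> 2 * x + 1 < B"
    and B: "length (enc_cnf (n, \<phi>)) < B" "2 < B" "2 ^ b < B"
    and R: "R 3 = 2 ^ b" "R 6 = t" "R 7 = k" "R 14 = t div 2 ^ b" "R 17 = b"
    and M: "M 0 = arr (enc_cnf (n, \<phi>))"
  shows "runs B read_sat (R, M) (20 * (length \<phi> + w) + 40)
    (\<lambda>(R', M'). M' = M \<and> R' 15 = of_bool (clause_fails b \<phi> t k))"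
proof -
  let ?s = "t mod 2 ^ b" and ?side = "t div 2 ^ b" and ?cl = "\<phi> ! k" and ?pos = "clause_pos \<phi> k"
  let ?fails = "\<lambda>i. \<forall>i' < i. \<not> literal_holds b ?side ?s (?cl ! i')"
  have len: "length \<phi> < length (enc_cnf (n, \<phi>))"
  proof -
    have "length \<psi> \<le> length (concat (map enc_clause \<psi>))" for \<psi>
      by (induction \<psi>) (auto simp: enc_clause_def)
    from this[of \<phi>] show ?thesis by (simp add: enc_cnf_eq)
  qed
  have pos: "M 0 ?pos = length ?cl" "length ?cl < B" "?pos + length ?cl < B"
    using nth_enc_cnf[OF k(1), of 0 n] nth_enc_cnf[OF k(1), of "length ?cl" n] M B
    by (auto simp: arr_def enc_clause_def)
  \<comment> \<open>The loop never stops early: \<open>?fails i\<close> covers the first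
    \<open>i\<close> literals and stays false once it is false.\<close>
  have test: "runs B (For 21 23 22 test_literal) (R', M) (length ?cl * (15 + 4) + 3)
      (\<lambda>(R', M'). M' = M \<and> R' 20 = ?pos + length ?cl \<and> R' 15 = of_bool (?fails (length ?cl)))"
    if R': "R' 20 = ?pos" "R' 24 = ?s" "R' 14 = ?side" "R' 17 = b" "R' 15 = 1" "R' 23 = length ?cl" for R'
  proof (rule runs_For[where I = "\<lambda>i R M'. M' = M \<and> R 20 = ?pos + i \<and> R 15 = of_bool (?fails i)"], goal_cases)
    case (11 i R1 M1)
    obtain x v where xv: "?cl ! i = (x, v)" by fastforce
    have nth: "M 0 (Suc (?pos + i)) = 2 * x + of_bool v" "Suc (?pos + i) < B"
      using nth_enc_cnf[OF k(1), of "Suc i" n] 11(1) M B xv by (auto simp: arr_def enc_clause_def)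
    have "2 * x + 1 < B" using lits[of x v] xv nth_mem[OF 11(1)] by simp
    moreover have "?s < B" using B(3) by (meson less_trans mod_less_divisor pos2 zero_less_power)
    moreover have "R1 24 = ?s" "R1 14 = ?side" "R1 17 = b"
      using 11(4) R' by (auto simp: test_literal_def decode_literal_def compare_bit_def)
    ultimately have "runs B test_literal (R1, M) 15 (\<lambda>(R', M'). M' = M \<and> R' 20 = ?pos + Suc i \<and>
      R' 15 = (if literal_holds b ?side ?s (x, v) then 0 else R1 15))"
      using 11(2) nth B by (intro runs_test_literal) auto
    then show ?case
      using 11(2) xv by (elim conjE, simp only:) (erule runs_mono; auto simp: less_Suc_eq)
  qed (use R' pos B in \<open>auto simp: test_literal_def decode_literal_def compare_bit_def\<close>)
  have skip: "runs B (For 21 7 22 skip_clause) (R', M) (k * (4 + 4) + 3)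
      (\<lambda>(R', M'). M' = M \<and> R' 20 = ?pos)" if R': "R' 20 = 2" "R' 7 = k" for R'
  proof (rule runs_For[where I = "\<lambda>j R M'. M' = M \<and> R 20 = clause_pos \<phi> j"], goal_cases)
    case (11 j R1 M1)
    then show ?case using runs_skip_clause[of R1 \<phi> j n B M] k B M by auto
  qed (use R' len k B in \<open>auto simp: skip_clause_def clause_pos_def\<close>)
  have "runs B read_sat (R, M) (Suc ((k * (4 + 4) + 3) + Suc (Suc (Suc (length ?cl * (15 + 4) + 3)))))
    (\<lambda>(R', M'). M' = M \<and> R' 20 = ?pos + length ?cl \<and> R' 15 = of_bool (?fails (length ?cl)))"
    unfolding read_sat_def
  proof (rule runs_Seq_Const)
    have "runs B (For 21 7 22 skip_clause) (R(20 := 2), M) (k * (4 + 4) + 3) (\<lambda>(R', M'). M' = M \<and> R' 20 = ?pos)"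
      by (rule skip) (use R in auto)
    from runs_frame[OF this]
    show "runs B (Seq (For 21 7 22 skip_clause) (Seq (Load 23 0 20) (Seq (Op OpMod 24 6 3)
        (Seq (Const 15 1) (For 21 23 22 test_literal))))) (R(20 := 2), M)
       ((k * (4 + 4) + 3) + Suc (Suc (Suc (length ?cl * (15 + 4) + 3))))
       (\<lambda>(R', M'). M' = M \<and> R' 20 = ?pos + length ?cl \<and> R' 15 = of_bool (?fails (length ?cl)))"
    proof (rule runs_Seq, clarify, goal_cases)
      case (1 R1 M1)
      have R1: "R1 3 = 2 ^ b" "R1 6 = t" "R1 14 = t div 2 ^ b" "R1 17 = b" "R1 20 = ?pos"
        using 1 R by (auto simp: skip_clause_def)
      have "?s < B" using B(3) by (meson less_trans mod_less_divisor pos2 zero_less_power)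
      then show ?case using R1 pos B
        by (intro runs_Seq_Load runs_Seq_Op runs_Seq_Const test) auto
    qed
  qed (use B in simp)
  then show ?thesis
  proof (rule runs_mono)
    show "Suc ((k * (4 + 4) + 3) + Suc (Suc (Suc (length ?cl * (15 + 4) + 3)))) \<le> 20 * (length \<phi> + w) + 40"
      using k by simp
    show "case s' of (R', M') \<Rightarrow> M' = M \<and> R' 15 = of_bool (clause_fails b \<phi> t k)"
      if "case s' of (R', M') \<Rightarrow> M' = M \<and> R' 20 = ?pos + length ?cl \<and> R' 15 = of_bool (?fails (length ?cl))" for s'
      using that by (auto simp: clause_fails_def all_set_conv_all_nth)
  qed
qed

lemma gadget_program_sat:
  assumes cls: "\<And>cl. cl \<in> set \<phi> \<Longrightarrow> length cl \<le> w" "\<And>cl x v. cl \<in> set \<phi> \<Longrightarrow> (x, v) \<in> set cl \<Longrightarrow> x < 2 * b"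
    and D: "D = length \<phi>" and \<tau>: "\<tau> = 20 * (D + w) + 40"
    and B: "(300 + 9 * K) * (2 ^ b * (D + 1) * (\<tau> + 1)) < B"
  shows "gadget_program B (arr (enc_cnf (n, \<phi>))) (2 ^ b) D b (clause_fails b \<phi>) read_sat \<tau>"
proof
  define p where "p = (2 :: nat) ^ b"
  define X where "X = D * D + D * w"
  have p: "0 < p" "b < p" by (simp_all add: p_def less_exp)
  \<comment> \<open>The summand without \<open>K\<close>, expanded into monomials, suffices for all
    word bounds of the query.\<close>
  have B': "300 * (p * (20 * X) + p * (20 * w) + 61 * (p * D) + p * 41) < B"
  proof -
    have "300 * (p * (D + 1) * (\<tau> + 1)) \<le> (300 + 9 * K) * (p * (D + 1) * (\<tau> + 1))"
      by (intro mult_right_mono) auto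
    also have "\<dots> < B" using B by (simp add: p_def)
    finally show ?thesis unfolding \<tau> X_def by (simp add: algebra_simps)
  qed
  have "20 * X \<le> p * (20 * X)" "20 * w \<le> p * (20 * w)" "61 * D \<le> 61 * (p * D)" using p by simp_all
  then have "20 * X + 20 * w + 61 * D + 41 * p \<le> p * (20 * X) + p * (20 * w) + 61 * (p * D) + p * 41"
    by linarith
  then have "300 * (20 * X + 20 * w + 61 * D + 41 * p) < B"
    using B' by (meson le_less_trans mult_le_mono2)
  then have bounds: "6000 * X + 6000 * w + 18300 * D + 12300 * p < B" by simp
  have enc: "length (enc_cnf (n, \<phi>)) \<le> 2 + D + X"
  proof -
    have "length (concat (map enc_clause \<phi>)) \<le> length \<phi> * (w + 1)"
      using cls(1) by (induction \<phi>) (force simp: enc_clause_def)+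
    then show ?thesis by (simp add: enc_cnf_eq D X_def algebra_simps)
  qed
  show "2 * 2 ^ b < B" "D < B" "core_size (2 ^ b) D + 1 + 2 * 2 ^ b < B"
    using bounds p unfolding p_def[symmetric] core_size_def by linarith+
  show "writes read_sat \<subseteq> {15} \<union> {20..<40}"
    by (auto simp: read_sat_def skip_clause_def test_literal_def decode_literal_def compare_bit_def)
  fix R ys t k
  assume R: "env (2 ^ b) D b R" "R 6 = t" "R 7 = k" "R 14 = t div 2 ^ b" and tk: "t < 2 * 2 ^ b" "k < D"
  show "runs B read_sat (R, mem (arr (enc_cnf (n, \<phi>))) ys) \<tau>
     (\<lambda>(R', M'). M' = mem (arr (enc_cnf (n, \<phi>))) ys \<and> R' 15 = of_bool (clause_fails b \<phi> t k))"
    unfolding \<tau> D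
  proof (rule runs_read_sat)
    \<comment> \<open>A literal code is below \<open>4 * b\<close>, and
      \<open>b < 2 ^ b\<close>.\<close>
    show "2 * x + 1 < B" if "(x, v) \<in> set (\<phi> ! k)" for x v
      using cls(2)[OF _ that] tk D p bounds by fastforce
    show "length (enc_cnf (n, \<phi>)) < B" using enc bounds p by linarith
    show "2 < B" "2 ^ b < B" using bounds p unfolding p_def[symmetric] by linarith+
  qed (use R tk D cls in \<open>auto simp: env_def mem_def\<close>)
qed

section \<open>Satisfying assignments as avoiding pairs\<close>

lemma exists_nat_with_bits: "\<exists>i < 2 ^ h. \<forall>x < h. bit (i :: nat) x = \<alpha> x"
  using horner_sum_of_bool_2_less[of "map \<alpha> [0..<h]"]
  by (intro exI[of _ "horner_sum of_bool 2 (map \<alpha> [0..<h])"]) (auto simp: bit_horner_sum_bit_iff)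

lemma avoiding_pair_sat:
  assumes lits: "\<And>cl x v. cl \<in> set \<phi> \<Longrightarrow> (x, v) \<in> set cl \<Longrightarrow> x < 2 * b"
  shows "avoiding_pair (2 ^ b) (length \<phi>) (clause_fails b \<phi>) \<longleftrightarrow> satisfiable (n, \<phi>)"
proof -
  \<comment> \<open>Stated for any \<open>\<alpha>\<close> that agrees with the bits of
    \<open>i\<close> and \<open>j\<close>, so that it serves both directions: gluing two numbers to
    an assignment and splitting an assignment into two numbers.\<close>
  have holds: "(\<forall>k < length \<phi>. \<not> (clause_fails b \<phi> i k \<and> clause_fails b \<phi> (2 ^ b + j) k)) \<longleftrightarrow>
      (\<forall>cl \<in> set \<phi>. \<exists>(x, v) \<in> set cl. \<alpha> x = v)"
    if ij: "i < 2 ^ b" "j < 2 ^ b" and \<alpha>: "\<And>x. x < b \<Longrightarrow> \<alpha> x = bit i x" "\<And>x. x < b \<Longrightarrow> \<alpha> (b + x) = bit j x"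
    for i j \<alpha>
  proof -
    have lit: "literal_holds b 0 i (x, v) \<or> literal_holds b 1 j (x, v) \<longleftrightarrow> \<alpha> x = v" if "x < 2 * b" for x v
    proof (cases "x < b")
      case True
      then show ?thesis using \<alpha> by (simp add: literal_holds_def)
    next
      case False
      define y where "y = x - b"
      have "x = b + y" "y < b" using False that by (auto simp: y_def)
      then show ?thesis using \<alpha> by (simp add: literal_holds_def)
    qed
    have side: "i div 2 ^ b = 0" "(2 ^ b + j) div 2 ^ b = 1" "i mod 2 ^ b = i" "(2 ^ b + j) mod 2 ^ b = j"
      using ij by auto
    have "\<not> (clause_fails b \<phi> i k \<and> clause_fails b \<phi> (2 ^ b + j) k) \<longleftrightarrow> (\<exists>(x, v) \<in> set (\<phi> ! k). \<alpha> x = v)"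
      if k: "k < length \<phi>" for k
    proof -
      have "\<not> (clause_fails b \<phi> i k \<and> clause_fails b \<phi> (2 ^ b + j) k) \<longleftrightarrow>
          (\<exists>l \<in> set (\<phi> ! k). literal_holds b 0 i l \<or> literal_holds b 1 j l)"
        unfolding clause_fails_def side by blast
      also have "\<dots> \<longleftrightarrow> (\<exists>(x, v) \<in> set (\<phi> ! k). \<alpha> x = v)"
      proof (rule bex_cong[OF refl])
        fix l assume l: "l \<in> set (\<phi> ! k)"
        obtain x v where [simp]: "l = (x, v)" by fastforce
        have "x < 2 * b" using lits[OF nth_mem[OF k]] l by simp
        then show "literal_holds b 0 i l \<or> literal_holds b 1 j l \<longleftrightarrow> (case l of (x, v) \<Rightarrow> \<alpha> x = v)"
          using lit[of x v] by simp
      qed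
      finally show ?thesis .
    qed
    then show ?thesis by (auto simp: all_set_conv_all_nth)
  qed
  show ?thesis
  proof
    assume "avoiding_pair (2 ^ b) (length \<phi>) (clause_fails b \<phi>)"
    then obtain i j where ij: "i < 2 ^ b" "j < 2 ^ b"
      "\<forall>k < length \<phi>. \<not> (clause_fails b \<phi> i k \<and> clause_fails b \<phi> (2 ^ b + j) k)"
      unfolding avoiding_pair_def by blast
    define \<beta> where "\<beta> x = (if x < b then bit i x else bit j (x - b))" for x
    have "\<forall>cl \<in> set \<phi>. \<exists>(x, v) \<in> set cl. \<beta> x = v"
      using ij holds[of i j \<beta>] by (simp add: \<beta>_def)
    then show "satisfiable (n, \<phi>)" unfolding satisfiable_def prod.case by (intro exI[of _ \<beta>])
  next
    assume "satisfiable (n, \<phi>)"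
    then obtain \<alpha> where \<alpha>: "\<forall>cl \<in> set \<phi>. \<exists>(x, v) \<in> set cl. \<alpha> x = v" by (auto simp: satisfiable_def)
    obtain i :: nat where i: "i < 2 ^ b" "\<forall>x < b. bit i x = \<alpha> x"
      using exists_nat_with_bits[of b \<alpha>] by blast
    obtain j :: nat where j: "j < 2 ^ b" "\<forall>x < b. bit j x = \<alpha> (b + x)"
      using exists_nat_with_bits[of b "\<lambda>x. \<alpha> (b + x)"] by blast
    show "avoiding_pair (2 ^ b) (length \<phi>) (clause_fails b \<phi>)"
      unfolding avoiding_pair_def
      by (rule exI[of _ i], rule conjI[OF i(1)], rule exI[of _ j], rule conjI[OF j(1)])
        (subst holds[of i j \<alpha>]; use i j \<alpha> in simp)
  qed
qed

section \<open>Running times\<close>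

lemma powr_bigo:
  fixes f g :: "nat \<Rightarrow> real"
  assumes "f \<in> O(g)" "\<And>n. 0 \<le> f n" "\<And>n. 0 \<le> g n" "0 \<le> a"
  shows "(\<lambda>n. f n powr a) \<in> O(\<lambda>n. g n powr a)"
proof -
  obtain c where c: "c > 0" "eventually (\<lambda>n. norm (f n) \<le> c * norm (g n)) at_top"
    using assms(1) by (elim landau_o.bigE)
  from c(2) have "eventually (\<lambda>n. norm (f n powr a) \<le> c powr a * norm (g n powr a)) at_top"
  proof eventually_elim
    case (elim n)
    then have "f n powr a \<le> (c * g n) powr a" using assms by (intro powr_mono2) auto
    also have "\<dots> = c powr a * g n powr a" using assms c by (simp add: powr_mult)
    finally show ?case by simp
  qed
  then show ?thesis by (rule landau_o.bigI[rotated]) (use c in simp)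
qed

text \<open>Inputs of equal size can yield gadgets of different sizes, and \<open>T\<close> need not
  be monotone. For nonnegative \<open>a\<close> this majorant is monotone, and it holds at every
  argument; the summand 1 covers \<open>n = 0\<close>, where the power vanishes.\<close>

lemma bigo_powr_uniform:
  fixes T :: "nat \<Rightarrow> nat"
  assumes "(\<lambda>n. real (T n)) \<in> O(\<lambda>n. real n powr a)"
  obtains c :: nat where "\<And>n. real (T n) \<le> real c * (1 + real n powr a)"
proof -
  obtain c where c: "c > 0" "eventually (\<lambda>n. norm (real (T n)) \<le> c * norm (real n powr a)) at_top"
    using assms by (elim landau_o.bigE)
  then obtain n0 where n0: "\<And>n. n \<ge> n0 \<Longrightarrow> real (T n) \<le> c * real n powr a"
    by (auto simp: eventually_at_top_linorder)
  \<comment> \<open>The finite sum dominates the values below the threshold, about which the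
    asymptotic bound says nothing.\<close>
  define c' where "c' = nat \<lceil>c\<rceil> + (\<Sum>n < n0. T n)"
  have "real (T n) \<le> real c' * (1 + real n powr a)" for n
  proof (cases "n < n0")
    case True
    then have "T n \<le> (\<Sum>n < n0. T n)" by (intro member_le_sum) auto
    then have "T n \<le> c'" by (simp add: c'_def)
    then have "real (T n) \<le> real c' * 1" by simp
    also have "\<dots> \<le> real c' * (1 + real n powr a)" by (intro mult_left_mono) auto
    finally show ?thesis .
  next
    case False
    have "c \<le> real c'" unfolding c'_def of_nat_add
      using real_nat_ceiling_ge[of c] of_nat_0_le_iff[of "\<Sum>n < n0. T n"] by linarith
    then have "c * real n powr a \<le> real c' * (1 + real n powr a)"
      using c(1) by (intro mult_mono) auto
    then show ?thesis using n0[of n] False by simp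
  qed
  then show ?thesis using that by blast
qed

lemma decidable_in_time_mono:
  "decidable_in_time Inst sz enc yes g \<Longrightarrow> g \<in> O(h) \<Longrightarrow> decidable_in_time Inst sz enc yes h"
  unfolding decidable_in_time_def using landau_o.big_trans by blast

text \<open>The decision procedure for the target problem is run on fresh registers and arrays, with its input
  in the array that the reduction has written. Its answer is negated.\<close>

lemma decidable_by_reduction:
  fixes X :: "nat \<Rightarrow> nat" and a :: real and f :: "'x \<Rightarrow> 'y"
  assumes dec: "decidable_in_time Inst' sz' enc' yes' (\<lambda>n. real n powr a)" and a: "0 \<le> a"
    and red: "\<And>x B. x \<in> Inst \<Longrightarrow> X (sz x) < B \<Longrightarrow> runs B red (init_state (enc x)) (X (sz x))
       (\<lambda>(R, M). (\<exists>A. M = mem A (enc' (f x))) \<and> (\<forall>r \<ge> 40. R r = 0))"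
    and f: "\<And>x. x \<in> Inst \<Longrightarrow> f x \<in> Inst'" "\<And>x. x \<in> Inst \<Longrightarrow> sz' (f x) \<le> X (sz x)"
       "\<And>x. x \<in> Inst \<Longrightarrow> yes' (f x) \<longleftrightarrow> \<not> yes x"
    and X: "(\<lambda>n. real (X n)) \<in> O(g)" "(\<lambda>n. real (X n) powr a) \<in> O(g)" "(\<lambda>_. 1) \<in> O(g)"
  shows "decidable_in_time Inst sz enc yes g"
proof -
  obtain P \<kappa> T where T: "(\<lambda>n. real (T n)) \<in> O(\<lambda>n. real n powr a)"
    and P: "\<And>y. y \<in> Inst' \<Longrightarrow> answers_within P ((sz' y + T (sz' y) + 2) ^ \<kappa>) (enc' y) (T (sz' y)) (yes' y)"
    using dec unfolding decidable_in_time_def by blast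
  obtain c where c: "\<And>n. real (T n) \<le> real c * (1 + real n powr a)"
    using bigo_powr_uniform[OF T] by blast
  define T' where "T' n = 2 * X n + 10 + c * (1 + nat \<lceil>real (X n) powr a\<rceil>)" for n
  \<comment> \<open>Register 40 is register 0 of the relocated \<open>P\<close>; comparing it with 0
    negates the answer.\<close>
  define P' where "P' = Seq red (Seq (shift 40 P) (Seq (Const 0 0) (Op OpEq 0 40 0)))"
  have "(\<lambda>n. real (T' n)) \<in> O(g)"
  proof -
    have "(\<lambda>n. real (T' n)) \<in> O(\<lambda>n. 2 * real (X n) + 10 * 1 + real c * (2 * 1 + real (X n) powr a))"
    proof (intro landau_o.big_mono always_eventually allI)
      fix n
      have "1 + real (nat \<lceil>real (X n) powr a\<rceil>) \<le> 2 * 1 + real (X n) powr a"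
        using powr_ge_zero[of "real (X n)" a] by linarith
      then have "real c * (1 + real (nat \<lceil>real (X n) powr a\<rceil>)) \<le> real c * (2 * 1 + real (X n) powr a)"
        by (rule mult_left_mono[OF _ of_nat_0_le_iff])
      moreover have "real (T' n) = 2 * real (X n) + 10 * 1 + real c * (1 + real (nat \<lceil>real (X n) powr a\<rceil>))"
        unfolding T'_def by (simp only: of_nat_add of_nat_mult of_nat_1 of_nat_numeral mult_1_right)
      ultimately show "norm (real (T' n)) \<le> norm (2 * real (X n) + 10 * 1 + real c * (2 * 1 + real (X n) powr a))"
        by (simp only: real_norm_def)
    qed
    also have "(\<lambda>n. 2 * real (X n) + 10 * 1 + real c * (2 * 1 + real (X n) powr a)) \<in> O(g)"
    proof -
      have cmult: "(\<lambda>n. k * u n) \<in> O(g)" if "u \<in> O(g)" for k :: real and u :: "nat \<Rightarrow> real"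
        using that by (cases "k = 0") simp_all
      show ?thesis
        by (intro sum_in_bigo(1) cmult[OF X(1)] cmult[OF X(3)] cmult[OF sum_in_bigo(1)[OF cmult[OF X(3)] X(2)]])
    qed
    finally show ?thesis .
  qed
  moreover have "answers_within P' ((sz x + T' (sz x) + 2) ^ (\<kappa> + 1)) (enc x) (T' (sz x)) (yes x)"
    if x: "x \<in> Inst" for x
  proof -
    let ?m = "sz x + T' (sz x) + 2" and ?N = "sz' (f x)"
    have "real ?N powr a \<le> real (X (sz x)) powr a" using f(2)[OF x] a by (intro powr_mono2) auto
    also have "\<dots> \<le> real (nat \<lceil>real (X (sz x)) powr a\<rceil>)" by (rule real_nat_ceiling_ge)
    finally have "real c * (1 + real ?N powr a) \<le> real (c * (1 + nat \<lceil>real (X (sz x)) powr a\<rceil>))"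
      unfolding of_nat_mult of_nat_add of_nat_1
      by (intro mult_left_mono add_left_mono of_nat_0_le_iff)
    then have T_le: "T ?N \<le> c * (1 + nat \<lceil>real (X (sz x)) powr a\<rceil>)"
      using c[of ?N] by linarith
    have "(?N + T ?N + 2) ^ \<kappa> \<le> ?m ^ \<kappa>"
      using T_le f(2)[OF x] by (intro power_mono) (auto simp: T'_def)
    also have "\<dots> \<le> ?m ^ (\<kappa> + 1)" by (intro power_increasing) auto
    finally have B_ge: "(?N + T ?N + 2) ^ \<kappa> \<le> ?m ^ (\<kappa> + 1)" .
    \<comment> \<open>The reason for the exponent \<open>\<kappa> + 1\<close>: with
      \<open>\<kappa> = 0\<close> a bound with exponent \<open>\<kappa>\<close> would be 1, too
      small for the reduction to run.\<close>
    have m_le: "?m \<le> ?m ^ (\<kappa> + 1)" by (rule self_le_power) simp_all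
    then have "X (sz x) < ?m ^ (\<kappa> + 1)" by (rule less_le_trans[rotated]) (simp add: T'_def)
    then obtain t1 R1 M1 A where 1: "exec (?m ^ (\<kappa> + 1)) red (init_state (enc x)) t1 (R1, M1)"
        "t1 \<le> X (sz x)" "M1 = mem A (enc' (f x))" "\<forall>r \<ge> 40. R1 r = 0"
      using red[OF x] unfolding runs_def by fastforce
    obtain t2 R2 M2 where 2: "exec ((?N + T ?N + 2) ^ \<kappa>) P (init_state (enc' (f x))) t2 (R2, M2)"
        "t2 \<le> T ?N" "R2 0 = of_bool (yes' (f x))"
      using P[OF f(1)[OF x]] unfolding answers_within_def by blast
    have "shifted 40 (init_state (enc' (f x))) (R1, M1)"
      using 1(3,4) by (auto simp: shifted_def init_state_def mem_def arr_def fun_eq_iff)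
    from exec_shift[OF exec_word_mono[OF 2(1) B_ge] this]
    obtain R3 M3 where 3: "exec (?m ^ (\<kappa> + 1)) (shift 40 P) (R1, M1) t2 (R3, M3)" "R3 40 = R2 0"
      by (auto simp: shifted_def) (metis add_0)
    have "runs (?m ^ (\<kappa> + 1)) (Seq (Const 0 0) (Op OpEq 0 40 0)) (R3, M3) (Suc 1)
        (\<lambda>(R', M'). R' 0 = of_bool (yes x))"
      using 3(2) 2(3) f(3)[OF x] m_le by (intro runs_line) auto
    then obtain t3 R4 M4 where 4: "exec (?m ^ (\<kappa> + 1)) (Seq (Const 0 0) (Op OpEq 0 40 0)) (R3, M3) t3 (R4, M4)"
        "t3 \<le> 2" "R4 0 = of_bool (yes x)"
      unfolding runs_def by auto
    have "exec (?m ^ (\<kappa> + 1)) P' (init_state (enc x)) (t1 + (t2 + t3)) (R4, M4)"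
      unfolding P'_def by (rule exec.Seq[OF 1(1) exec.Seq[OF 3(1) 4(1)]])
    moreover have "t1 + (t2 + t3) \<le> T' (sz x)" using 1(2) 2(2) 4(2) T_le unfolding T'_def by linarith
    ultimately show ?thesis using 4(3) unfolding answers_within_def by blast
  qed
  ultimately show ?thesis unfolding decidable_in_time_def by blast
qed

section \<open>Transfer of running times to orthogonal vectors and satisfiability\<close>

lemma ov_decidable:
  fixes C \<epsilon> c :: real
  assumes dec: "decidable_in_time (sparse_instances C) fst enc_graph yesG (\<lambda>n. real n powr (2 - \<epsilon>))"
    and yesG: "\<And>K p D Q. yesG (gadget K p D Q) \<longleftrightarrow> \<not> avoiding_pair p D Q"
    and C: "0 < C" and \<epsilon>: "0 < \<epsilon>" "\<epsilon> \<le> 1" and c: "1 \<le> c"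
  shows "decidable_in_time (ov_instances c) length enc_ov has_orthogonal_pair
           (\<lambda>n. real n powr (2 - \<epsilon> / 2))"
proof -
  define K where "K = nat \<lceil>1 / C\<rceil>"
  define D where "D n = nat \<lceil>c * log 2 (real n)\<rceil>" for n :: nat
  define X where "X n = (300 + 9 * K) * (n * (D n + 1) * (6 + 1)) + 10" for n
  define red where "red = Seq (Const 20 0) (Seq (Load 3 0 20) (Seq (Const 20 1) (Seq (Load 4 0 20) (build K read_ov))))"
  define f where "f vs = gadget K (length vs) (D (length vs)) (ov_entry vs)" for vs
  have K: "1 / C \<le> real K" unfolding K_def by (rule real_nat_ceiling_ge)
  have inst: "vs \<noteq> []" "\<And>v. v \<in> set vs \<Longrightarrow> length v = D (length vs)" "\<And>v. v \<in> set vs \<Longrightarrow> set v \<subseteq> {0, 1}"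
    if "vs \<in> ov_instances c" for vs
    using that by (auto simp: ov_instances_def D_def)
  show ?thesis
  proof (rule decidable_by_reduction[OF dec, where X = X and red = red and f = f])
    fix vs B assume vs: "vs \<in> ov_instances c" and XB: "X (length vs) < B"
    let ?p = "length vs" let ?D = "D ?p"
    interpret gadget_program B "arr (enc_ov vs)" ?p ?D 0 "ov_entry vs" read_ov 6
      by (rule gadget_program_ov[OF inst[OF vs], where K = K]) (use XB in \<open>auto simp: X_def\<close>)
    let ?R = "((\<lambda>_. 0)(20 := 0, 3 := ?p, 20 := 1, 4 := ?D)) :: nat \<Rightarrow> nat"
    have A: "arr (enc_ov vs) 0 = ?p" "arr (enc_ov vs) 1 = ?D"
      using inst(1,2)[OF vs] by (auto simp: arr_def enc_ov_def)
    have b: "runs B (build K read_ov) (?R, mem (arr (enc_ov vs)) []) (300 * (?p * (?D + 1) * (6 + 1)))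
      (\<lambda>(R', M'). M' = mem (arr (enc_ov vs)) (enc_graph (f vs)) \<and> (\<forall>r \<ge> 40. R' r = ?R r))"
      unfolding f_def using inst(1)[OF vs] XB by (intro build_runs) (auto simp: X_def)
    have "runs B red (init_state (enc_ov vs)) (Suc (Suc (Suc (Suc (300 * (?p * (?D + 1) * (6 + 1)))))))
      (\<lambda>(R', M'). M' = mem (arr (enc_ov vs)) (enc_graph (f vs)) \<and> (\<forall>r \<ge> 40. R' r = ?R r))"
      unfolding red_def init_state_mem using b A B_gt_1 B(1,2)
      by (intro runs_line) (auto simp: mem_def)
    moreover have "300 * (?p * (?D + 1) * (6 + 1)) \<le> (300 + 9 * K) * (?p * (?D + 1) * (6 + 1))"
      by (intro mult_right_mono) auto
    then have "Suc (Suc (Suc (Suc (300 * (?p * (?D + 1) * (6 + 1)))))) \<le> X ?p" by (simp add: X_def)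
    ultimately show "runs B red (init_state (enc_ov vs)) (X ?p)
       (\<lambda>(R, M). (\<exists>A. M = mem A (enc_graph (f vs))) \<and> (\<forall>r \<ge> 40. R r = 0))"
      by (rule runs_mono) auto
  next
    fix vs assume vs: "vs \<in> ov_instances c"
    show "f vs \<in> sparse_instances C" unfolding f_def by (rule gadget_sparse[OF C K])
    show "fst (f vs) \<le> X (length vs)"
      using gadget_size[of "length vs" K "D (length vs)" "ov_entry vs" 6] inst(1)[OF vs]
      by (simp add: f_def X_def)
    show "yesG (f vs) \<longleftrightarrow> \<not> has_orthogonal_pair vs"
      using avoiding_pair_ov[OF inst(2,3)[OF vs]] by (simp add: f_def yesG)
  next
    show "0 \<le> 2 - \<epsilon>" using \<epsilon> by simp
    \<comment> \<open>Logarithmic factors are absorbed into \<open>n powr \<delta>\<close>. Since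
      the exponent of the algorithm is about 2, this spends at most half of the saving
      \<open>\<epsilon>\<close>.\<close>
    define \<delta> where "\<delta> = \<epsilon> / 4"
    have \<delta>: "0 < \<delta>" using \<epsilon> by (simp add: \<delta>_def)
    have "(\<lambda>n. real (X n)) \<in> O(\<lambda>n. real (300 + 9 * K) * (real n * (c * log 2 (real n) + 2) * 7) + 10)"
    proof (intro landau_o.big_mono always_eventually allI)
      fix n :: nat
      have "0 \<le> c * log 2 (real n)" using c by (cases "n = 0") (auto simp: log_def)
      then have "real (D n) \<le> c * log 2 (real n) + 1" unfolding D_def by linarith
      then have "real n * (real (D n) + 1) \<le> real n * (c * log 2 (real n) + 2)"
        by (intro mult_left_mono) auto
      then have "real (300 + 9 * K) * (real n * (real (D n) + 1) * 7) \<le>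
          real (300 + 9 * K) * (real n * (c * log 2 (real n) + 2) * 7)"
        by (intro mult_left_mono) auto
      then show "norm (real (X n)) \<le> norm (real (300 + 9 * K) * (real n * (c * log 2 (real n) + 2) * 7) + 10)"
        by (simp add: X_def algebra_simps)
    qed
    also have "(\<lambda>n. real (300 + 9 * K) * (real n * (c * log 2 (real n) + 2) * 7) + 10) \<in> O(\<lambda>n. real n powr (1 + \<delta>))"
      using \<delta> by real_asymp
    finally have X: "(\<lambda>n. real (X n)) \<in> O(\<lambda>n. real n powr (1 + \<delta>))" .
    also have "(\<lambda>n. real n powr (1 + \<delta>)) \<in> O(\<lambda>n. real n powr (2 - \<epsilon> / 2))"
    proof -
      \<comment> \<open>Here \<open>\<epsilon> \<le> 1\<close> ensures that writing the graph is
        itself fast enough.\<close>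
      have "1 + \<delta> < 2 - \<epsilon> / 2" using \<epsilon> by (simp add: \<delta>_def)
      then show ?thesis by real_asymp
    qed
    finally show "(\<lambda>n. real (X n)) \<in> O(\<lambda>n. real n powr (2 - \<epsilon> / 2))" .
    have "(\<lambda>n. real (X n) powr (2 - \<epsilon>)) \<in> O(\<lambda>n. (real n powr (1 + \<delta>)) powr (2 - \<epsilon>))"
      using X \<epsilon> by (intro powr_bigo) auto
    also have "(\<lambda>n. (real n powr (1 + \<delta>)) powr (2 - \<epsilon>)) = (\<lambda>n. real n powr ((1 + \<delta>) * (2 - \<epsilon>)))"
      by (simp add: powr_powr)
    also have "\<dots> \<in> O(\<lambda>n. real n powr (2 - \<epsilon> / 2))"
    proof -
      have "(1 + \<delta>) * (2 - \<epsilon>) = 2 - \<epsilon> / 2 - \<epsilon> * \<epsilon> / 4" by (simp add: \<delta>_def field_simps)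
      also have "\<dots> < 2 - \<epsilon> / 2" using \<epsilon> by simp
      finally show ?thesis by real_asymp
    qed
    finally show "(\<lambda>n. real (X n) powr (2 - \<epsilon>)) \<in> O(\<lambda>n. real n powr (2 - \<epsilon> / 2))" .
    have "0 < 2 - \<epsilon> / 2" using \<epsilon> by simp
    then show "(\<lambda>_. 1) \<in> O(\<lambda>n. real n powr (2 - \<epsilon> / 2))" by real_asymp
  qed
qed

text \<open>Clauses that are distinct as sets are distinct as lists, and there are only polynomially
  many lists of at most \<open>w\<close> literals for fixed \<open>w\<close>. This keeps the
  dimension \<open>D\<close> polynomial in \<open>n\<close>.\<close>

lemma length_ksat_le:
  assumes "(n, \<phi>) \<in> ksat_instances w"
  shows "length \<phi> \<le> (w + 1) * (2 * n + 1) ^ w"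
proof -
  let ?L = "{..<n} \<times> (UNIV :: bool set)"
  have "set \<phi> \<subseteq> {cl. set cl \<subseteq> ?L \<and> length cl \<le> w}"
    using assms by (fastforce simp: ksat_instances_def)
  then have "card (set \<phi>) \<le> card {cl. set cl \<subseteq> ?L \<and> length cl \<le> w}"
    by (intro card_mono finite_lists_length_le) auto
  also have "\<dots> = (\<Sum>i\<le>w. card ?L ^ i)" by (rule card_lists_length_le) simp
  \<comment> \<open>The base \<open>2 * n + 1\<close> is positive even for \<open>n = 0\<close>, so
    its powers increase with the exponent.\<close>
  also have "\<dots> \<le> (\<Sum>i\<le>w. (2 * n + 1) ^ w)"
  proof (rule sum_mono)
    fix i assume "i \<in> {..w}"
    have "card ?L ^ i \<le> (2 * n + 1) ^ i" by (intro power_mono) (auto simp: card_cartesian_product)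
    also have "\<dots> \<le> (2 * n + 1) ^ w" using \<open>i \<in> _\<close> by (intro power_increasing) auto
    finally show "card ?L ^ i \<le> (2 * n + 1) ^ w" .
  qed
  also have "\<dots> = (w + 1) * (2 * n + 1) ^ w" by simp
  finally show ?thesis
    using assms distinct_card[of \<phi>] by (auto simp: ksat_instances_def distinct_map)
qed


lemma exponential_bigo:
  fixes a b :: real
  assumes "a \<le> b"
  shows "(\<lambda>n. 2 powr (a * real n)) \<in> O(\<lambda>n. 2 powr (b * real n))"
  using assms by (intro landau_o.big_mono always_eventually allI) (simp add: mult_right_mono)

text \<open>The gadget size is 2 to the \<open>n / 2\<close> up to polynomial factors, so raising it
  to the power \<open>2 - \<epsilon>\<close> falls below 2 to the \<open>n\<close> by a constant
  factor in the exponent. The width \<open>w\<close> only affects the polynomial, so the same saving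
  holds for every \<open>w\<close>.\<close>

lemma ksat_decidable:
  fixes C \<epsilon> :: real
  assumes dec: "decidable_in_time (sparse_instances C) fst enc_graph yesG (\<lambda>n. real n powr (2 - \<epsilon>))"
    and yesG: "\<And>K p D Q. yesG (gadget K p D Q) \<longleftrightarrow> \<not> avoiding_pair p D Q"
    and C: "0 < C" and \<epsilon>: "0 < \<epsilon>" "\<epsilon> \<le> 1"
  shows "decidable_in_time (ksat_instances w) fst enc_cnf satisfiable
           (\<lambda>n. 2 powr ((1 - \<epsilon> / 4) * real n))"
proof -
  define K where "K = nat \<lceil>1 / C\<rceil>"
  \<comment> \<open>Rounded up, so that two halves cover all variables; for odd \<open>n\<close> one
    of the \<open>2 * h n\<close> variables occurs in no clause.\<close>
  define h where "h n = (n + 1) div 2" for n :: nat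
  define \<tau> where "\<tau> D = 20 * (D + w) + 40" for D
  define U where "U n D = 2 ^ h n * (D + 1) * (\<tau> D + 1)" for n D
  define Dmax where "Dmax n = (w + 1) * (2 * n + 1) ^ w" for n
  \<comment> \<open>The summands \<open>n + 10\<close> leave room for the registers holding
    \<open>n\<close> and \<open>n + 1\<close> and for the eight instructions before
    \<open>build\<close>.\<close>
  define X where "X n = (300 + 9 * K) * U n (Dmax n) + n + 10" for n
  define red where "red = Seq (Const 20 0) (Seq (Load 21 0 20) (Seq (Const 20 1) (Seq (Load 4 0 20)
     (Seq (Op OpAdd 21 21 20) (Seq (Const 22 2) (Seq (Op OpDiv 17 21 22) (Seq (Op OpShl 3 20 17)
     (build K read_sat))))))))"
  define f where "f = (\<lambda>(n, \<phi>). gadget K (2 ^ h n) (length \<phi>) (clause_fails (h n) \<phi>))"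
  have K: "1 / C \<le> real K" unfolding K_def by (rule real_nat_ceiling_ge)
  have h: "n \<le> 2 * h n" "h n \<le> n" for n by (auto simp: h_def)
  have lits: "x < 2 * h n" if "(n, \<phi>) \<in> ksat_instances w" "cl \<in> set \<phi>" "(x, v) \<in> set cl" for n \<phi> cl x v
  proof -
    have "x < n" using that by (fastforce simp: ksat_instances_def)
    then show ?thesis using h(1)[of n] by linarith
  qed
  have U_le: "(300 + 9 * K) * U n (length \<phi>) + n + 10 \<le> X n" if "(n, \<phi>) \<in> ksat_instances w" for n \<phi>
  proof -
    have "length \<phi> \<le> Dmax n" using length_ksat_le[OF that] by (simp add: Dmax_def)
    then have "U n (length \<phi>) \<le> U n (Dmax n)"
      unfolding U_def \<tau>_def by (intro mult_mono) auto
    then show ?thesis by (simp add: X_def)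
  qed
  show ?thesis
  proof (rule decidable_by_reduction[OF dec, where X = X and red = red and f = f])
    fix x B assume x: "x \<in> ksat_instances w" and XB: "X (fst x) < B"
    obtain n \<phi> where [simp]: "x = (n, \<phi>)" by fastforce
    have inst: "(n, \<phi>) \<in> ksat_instances w" using x by simp
    have UB: "(300 + 9 * K) * U n (length \<phi>) + n + 10 < B" using U_le[OF inst] XB by simp
    let ?A = "arr (enc_cnf (n, \<phi>))" and ?D = "length \<phi>" and ?p = "2 ^ h n :: nat"
    interpret gadget_program B ?A ?p ?D "h n" "clause_fails (h n) \<phi>" read_sat "\<tau> ?D"
    proof (rule gadget_program_sat[where K = K and w = w])
      show "length cl \<le> w" if "cl \<in> set \<phi>" for cl using inst that by (auto simp: ksat_instances_def)
      show "(300 + 9 * K) * (2 ^ h n * (?D + 1) * (\<tau> ?D + 1)) < B" using UB by (simp add: U_def)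
    qed (use lits[OF inst] in \<open>auto simp: \<tau>_def\<close>)
    let ?R = "((\<lambda>_. 0)(20 := 0, 21 := n, 20 := 1, 4 := ?D, 21 := n + 1, 22 := 2, 17 := h n, 3 := ?p)) :: nat \<Rightarrow> nat"
    have A: "?A 0 = n" "?A 1 = ?D" by (auto simp: arr_def enc_cnf_def)
    have b: "runs B (build K read_sat) (?R, mem ?A []) (300 * (?p * (?D + 1) * (\<tau> ?D + 1)))
      (\<lambda>(R', M'). M' = mem ?A (enc_graph (f x)) \<and> (\<forall>r \<ge> 40. R' r = ?R r))"
      unfolding f_def \<open>x = (n, \<phi>)\<close> prod.case using UB by (intro build_runs) (auto simp: U_def)
    have "h n < B" using h(2)[of n] UB by linarith
    moreover have "?p < B" using B(1) by simp
    moreover have "push_bit (h n) 1 = ?p" by (simp add: push_bit_eq_mult)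
    ultimately have "runs B red (init_state (enc_cnf x))
      (Suc (Suc (Suc (Suc (Suc (Suc (Suc (Suc (300 * (?p * (?D + 1) * (\<tau> ?D + 1)))))))))))
      (\<lambda>(R', M'). M' = mem ?A (enc_graph (f x)) \<and> (\<forall>r \<ge> 40. R' r = ?R r))"
      unfolding red_def init_state_mem using b A B_gt_1 B(1,2) UB h_def[of n]
      by (intro runs_line) (auto simp: mem_def)
    moreover have "300 * (?p * (?D + 1) * (\<tau> ?D + 1)) \<le> (300 + 9 * K) * U n ?D"
      unfolding U_def by (intro mult_right_mono) auto
    then have "Suc (Suc (Suc (Suc (Suc (Suc (Suc (Suc (300 * (?p * (?D + 1) * (\<tau> ?D + 1)))))))))) \<le> X n"
      using U_le[OF inst] by linarith
    ultimately show "runs B red (init_state (enc_cnf x)) (X (fst x))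
       (\<lambda>(R, M). (\<exists>A. M = mem A (enc_graph (f x))) \<and> (\<forall>r \<ge> 40. R r = 0))"
      by (elim runs_mono) auto
  next
    fix x assume x: "x \<in> ksat_instances w"
    obtain n \<phi> where [simp]: "x = (n, \<phi>)" by fastforce
    show "f x \<in> sparse_instances C" unfolding f_def by (simp add: gadget_sparse[OF C K])
    show "fst (f x) \<le> X (fst x)"
      using gadget_size[of "2 ^ h n" K "length \<phi>" "clause_fails (h n) \<phi>" "\<tau> (length \<phi>)"] U_le[of n \<phi>] x
      by (simp add: f_def U_def)
    show "yesG (f x) \<longleftrightarrow> \<not> satisfiable x"
      using avoiding_pair_sat[of \<phi> "h n" n] lits[of n \<phi>] x by (simp add: f_def yesG)
  next
    show "0 \<le> 2 - \<epsilon>" using \<epsilon> by simp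
    \<comment> \<open>Polynomial factors and the rounding of \<open>n / 2\<close> are absorbed into
      2 to the \<open>\<delta> * n\<close>; with this choice
      \<open>(1 / 2 + \<delta>) * (2 - \<epsilon>)\<close> stays below
      \<open>1 - \<epsilon> / 4\<close>.\<close>
    define \<delta> where "\<delta> = \<epsilon> / 8"
    have \<delta>: "0 < \<delta>" using \<epsilon> by (simp add: \<delta>_def)
    define q where "q n = (real w + 1) * (2 * real n + 1) ^ w" for n :: nat
    have "(\<lambda>n. real (X n)) \<in> O(\<lambda>n. real (300 + 9 * K) *
        (2 powr ((real n + 1) / 2) * (q n + 1) * (20 * (q n + real w) + 41)) + real n + 10)"
    proof (intro landau_o.big_mono always_eventually allI)
      fix n :: nat
      have "real (2 * h n) \<le> real (n + 1)" unfolding of_nat_le_iff h_def by simp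
      then have "real (h n) \<le> (real n + 1) / 2" by simp
      then have "real (2 ^ h n) \<le> 2 powr ((real n + 1) / 2)"
        by (simp add: powr_realpow[symmetric])
      then have "real (2 ^ h n) * (q n + 1) * (20 * (q n + real w) + 41)
          \<le> 2 powr ((real n + 1) / 2) * (q n + 1) * (20 * (q n + real w) + 41)"
        by (intro mult_right_mono) (auto simp: q_def)
      moreover have "real (U n (Dmax n)) = real (2 ^ h n) * (q n + 1) * (20 * (q n + real w) + 41)"
      proof -
        have "q n = real (Dmax n)" by (simp add: Dmax_def q_def algebra_simps)
        then show ?thesis by (simp add: U_def \<tau>_def algebra_simps)
      qed
      ultimately have "real (300 + 9 * K) * real (U n (Dmax n)) \<le> real (300 + 9 * K) *
          (2 powr ((real n + 1) / 2) * (q n + 1) * (20 * (q n + real w) + 41))"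
        by (intro mult_left_mono) auto
      then have "real (X n) \<le> real (300 + 9 * K) *
          (2 powr ((real n + 1) / 2) * (q n + 1) * (20 * (q n + real w) + 41)) + real n + 10"
        unfolding X_def of_nat_add of_nat_mult by simp
      then show "norm (real (X n)) \<le> norm (real (300 + 9 * K) *
          (2 powr ((real n + 1) / 2) * (q n + 1) * (20 * (q n + real w) + 41)) + real n + 10)"
        by (simp only: real_norm_def)
    qed
    also have "(\<lambda>n. real (300 + 9 * K) * (2 powr ((real n + 1) / 2) * (q n + 1) *
        (20 * (q n + real w) + 41)) + real n + 10) \<in> O(\<lambda>n. 2 powr ((1 / 2 + \<delta>) * real n))"
      unfolding q_def using \<delta> by real_asymp
    finally have X: "(\<lambda>n. real (X n)) \<in> O(\<lambda>n. 2 powr ((1 / 2 + \<delta>) * real n))" .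
    also have "(\<lambda>n. 2 powr ((1 / 2 + \<delta>) * real n)) \<in> O(\<lambda>n. 2 powr ((1 - \<epsilon> / 4) * real n))"
    proof -
      have "1 / 2 + \<delta> \<le> 1 - \<epsilon> / 4" using \<epsilon> by (simp add: \<delta>_def)
      then show ?thesis by (rule exponential_bigo)
    qed
    finally show "(\<lambda>n. real (X n)) \<in> O(\<lambda>n. 2 powr ((1 - \<epsilon> / 4) * real n))" .
    have "(\<lambda>n. real (X n) powr (2 - \<epsilon>)) \<in> O(\<lambda>n. (2 powr ((1 / 2 + \<delta>) * real n)) powr (2 - \<epsilon>))"
      using X \<epsilon> by (intro powr_bigo) auto
    also have "(\<lambda>n. (2 powr ((1 / 2 + \<delta>) * real n)) powr (2 - \<epsilon>)) =
        (\<lambda>n. 2 powr (((1 / 2 + \<delta>) * (2 - \<epsilon>)) * real n))"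
      by (simp add: powr_powr mult_ac)
    also have "\<dots> \<in> O(\<lambda>n. 2 powr ((1 - \<epsilon> / 4) * real n))"
    proof -
      have "(1 / 2 + \<delta>) * (2 - \<epsilon>) = 1 - \<epsilon> / 4 - \<epsilon> * \<epsilon> / 8" by (simp add: \<delta>_def field_simps)
      also have "\<dots> \<le> 1 - \<epsilon> / 4" by simp
      finally show ?thesis by (rule exponential_bigo)
    qed
    finally show "(\<lambda>n. real (X n) powr (2 - \<epsilon>)) \<in> O(\<lambda>n. 2 powr ((1 - \<epsilon> / 4) * real n))" .
    show "(\<lambda>_. 1) \<in> O(\<lambda>n. 2 powr ((1 - \<epsilon> / 4) * real n))"
      using exponential_bigo[of 0 "1 - \<epsilon> / 4"] \<epsilon> by simp
  qed
qed

text \<open>Only the answers on gadgets matter, so isometry and convexity become two instances of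
  the same argument.\<close>

lemma hypotheses_fail:
  fixes C \<epsilon> :: real
  assumes dec: "decidable_in_time (sparse_instances C) fst enc_graph yesG (\<lambda>n. real n powr (2 - \<epsilon>))"
    and yesG: "\<And>K p D Q. yesG (gadget K p D Q) \<longleftrightarrow> \<not> avoiding_pair p D Q"
    and C: "0 < C" and \<epsilon>: "0 < \<epsilon>"
  shows "\<not> OVC \<and> \<not> SETH"
proof -
  \<comment> \<open>A faster algorithm also meets the weaker bound. Capping at 1 keeps the exponent
    nonnegative, hence the bound monotone, and leaves time for writing the graph.\<close>
  define \<epsilon>' where "\<epsilon>' = min \<epsilon> 1"
  have \<epsilon>': "0 < \<epsilon>'" "\<epsilon>' \<le> 1" using \<epsilon> by (auto simp: \<epsilon>'_def)
  have "2 - \<epsilon> = 2 - \<epsilon>' \<or> 2 - \<epsilon> < 2 - \<epsilon>'" by (auto simp: \<epsilon>'_def)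
  then have "(\<lambda>n. real n powr (2 - \<epsilon>)) \<in> O(\<lambda>n. real n powr (2 - \<epsilon>'))"
  proof
    assume "2 - \<epsilon> < 2 - \<epsilon>'"
    then show ?thesis by real_asymp
  qed simp
  then have dec': "decidable_in_time (sparse_instances C) fst enc_graph yesG (\<lambda>n. real n powr (2 - \<epsilon>'))"
    by (rule decidable_in_time_mono[OF dec])
  show ?thesis
  proof
    show "\<not> OVC"
      unfolding OVC_def using ov_decidable[OF dec' yesG C \<epsilon>'] \<epsilon>'(1) half_gt_zero by blast
    show "\<not> SETH"
      unfolding SETH_def using ksat_decidable[OF dec' yesG C \<epsilon>'] \<epsilon>'(1)
      by (metis divide_pos_pos zero_less_numeral)
  qed
qed

theorem theorem9:
  fixes \<epsilon> C :: real
  assumes "\<epsilon> > 0" and "C > 0"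
  shows "(isometric_decidable C (\<lambda>n. real n powr (2 - \<epsilon>)) \<longrightarrow> \<not> OVC \<and> \<not> SETH) \<and>
         (convex_decidable C (\<lambda>n. real n powr (2 - \<epsilon>)) \<longrightarrow> \<not> OVC \<and> \<not> SETH)"
proof (intro conjI[of "_ \<longrightarrow> _"] impI)
  assume "isometric_decidable C (\<lambda>n. real n powr (2 - \<epsilon>))"
  then show "\<not> OVC \<and> \<not> SETH"
    unfolding isometric_decidable_def
    by (rule hypotheses_fail) (use gadget_convex gadget_not_isometric convex_imp_isometric assms in blast)+
next
  assume "convex_decidable C (\<lambda>n. real n powr (2 - \<epsilon>))"
  then show "\<not> OVC \<and> \<not> SETH"
    unfolding convex_decidable_def
    by (rule hypotheses_fail) (use gadget_convex gadget_not_isometric convex_imp_isometric assms in blast)+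
qed

end
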